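(* Let $\Omega$ be a bounded open subset of $\mathbb{R}^d$, $d\geq 1$. Let $\mathcal{A}$ be a (nonempty) compact metric space, let $a\in C(\overline{\Omega}\times \mathcal{A};\mathbb{R}^{d\times d}_{\mathrm{sym}})$, and let $f\in C(\overline{\Omega}\times \mathcal{A})$. Let $F\colon L^2(\Omega)\to L^2(\Omega)$ be an operator and let $G\in V^*$. If $(u,m)\in V\times L^2(\Omega)$ is a solution of the PDI problem and if $m\geq 0$ a.e. in $\Omega$, then $(u,m)$ is a solution of the VI problem. Conversely, if $(u,m)\in V\times L^2_+(\Omega)$ is a solution of the VI problem, then $(u,m)$ is a solution of the PDI problem.
   Context: Notation: $\mathbb{R}^{d\times d}_{\mathrm{sym}}$ is the space of real symmetric $d\times d$ matrices; $A:B=\sum_{i,j}A_{ij}B_{ij}$. $(\cdot,\cdot)_\Omega$ is the inner product of $L^2(\Omega)$ and $L^2_+(\Omega)$ is the set of functions in $L^2(\Omega)$ that are nonnegative a.e. in $\Omega$. $V:=H^2(\Omega)\cap H^1_0(\Omega)$ with the norm and inner product of $H^2(\Omega)$; $V^*$ is its dual, with duality pairing $\langle\cdot,\cdot\rangle_{V^*\times V}$. Hamiltonian: $H(x,M):=\sup_{\alpha\in\mathcal{A}}\{-a(x,\alpha):M-f(x,\alpha)\}$ for $(x,M)\in\overline{\Omega}\times\mathbb{R}^{d\times d}_{\mathrm{sym}}$. For $v\in V$, $H[v]\in L^2(\Omega)$ is given by $H[v](x):=H(x,D^2v(x))$ for a.e. $x\in\Omega$. The partial subdifferential is $\partial_M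 H(x,M):=\{A\in\mathbb{R}^{d\times d}_{\mathrm{sym}}: H(x,M)+A:(\widetilde M-M)\leq H(x,\widetilde M)\ \forall \widetilde M\in\mathbb{R}^{d\times d}_{\mathrm{sym}}\}$. For $v\in V$, $\mathcal{D}H[v]:=\{A\in L^\infty(\Omega;\mathbb{R}^{d\times d}_{\mathrm{sym}}): A(x)\in\partial_M H(x,D^2v(x))\text{ for a.e. }x\in\Omega\}$. PDI problem: $(u,m)\in V\times L^2(\Omega)$ is a solution of the PDI problem if $H[u]=F[m]$ a.e. in $\Omega$ and there exists $-\overline{a}\in\mathcal{D}H[u]$ such that $(m,-\overline{a}:D^2v)_\Omega=\langle G,v\rangle_{V^*\times V}$ for all $v\in V$. VI problem: $(u,m)\in V\times L^2_+(\Omega)$ is a solution of the VI problem if $H[u]=F[m]$ a.e. in $\Omega$ and $\langle G,v-u\rangle_{V^*\times V}\leq (m,H[v]-H[u])_\Omega$ for all $v\in V$. *)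

theory Defs
  imports "HOL-Analysis.Analysis"
begin

text \<open>
  Elements of \<open>L\<^sup>2(\<Omega>)\<close>, \<open>L\<^sup>\<infinity>(\<Omega>)\<close> and of the Sobolev spaces are represented by functions on the
  whole of \<open>\<real>\<^sup>d\<close>, of which only the restriction to \<open>\<Omega>\<close>, up to Lebesgue null sets, is relevant.
  The product \<open>A : B\<close> of matrices is the library inner product \<open>A \<bullet> B\<close> on \<^typ>\<open>real^'d^'d\<close>, which
  unfolds to the sum of all \<open>A $ i $ j * B $ i $ j\<close>.
\<close>

definition L2 :: "(real^'d::finite) set \<Rightarrow> (real^'d \<Rightarrow> real) set" where
  "L2 \<Omega> = {v. v \<in> borel_measurable (lebesgue_on \<Omega>) \<and> integrable (lebesgue_on \<Omega>) (\<lambda>x. (v x)\<^sup>2)}"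

definition L2_nonneg :: "(real^'d::finite) set \<Rightarrow> (real^'d \<Rightarrow> real) set" where
  "L2_nonneg \<Omega> = {v \<in> L2 \<Omega>. AE x in lebesgue_on \<Omega>. 0 \<le> v x}"

definition L2_inner :: "(real^'d::finite) set \<Rightarrow> (real^'d \<Rightarrow> real) \<Rightarrow> (real^'d \<Rightarrow> real) \<Rightarrow> real" where
  "L2_inner \<Omega> v w = (LINT x|lebesgue_on \<Omega>. v x * w x)"

definition sym_matrices :: "(real^'d^'d::finite) set" where
  "sym_matrices = {M. transpose M = M}"

definition Linfty_sym :: "(real^'d::finite) set \<Rightarrow> (real^'d \<Rightarrow> real^'d^'d) set" where
  "Linfty_sym \<Omega> = {A. A \<in> borel_measurable (lebesgue_on \<Omega>) \<and>
     (\<exists>C. AE x in lebesgue_on \<Omega>. norm (A x) \<le> C) \<and>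
     (AE x in lebesgue_on \<Omega>. A x \<in> sym_matrices)}"

text \<open>An operator on \<open>L\<^sup>2(\<Omega>)\<close>, as an operation on representatives that respects equality a.e.\<close>

definition L2_operator :: "(real^'d::finite) set \<Rightarrow> ((real^'d \<Rightarrow> real) \<Rightarrow> (real^'d \<Rightarrow> real)) \<Rightarrow> bool" where
  "L2_operator \<Omega> F \<longleftrightarrow>
     (\<forall>m\<in>L2 \<Omega>. F m \<in> L2 \<Omega>) \<and>
     (\<forall>m\<in>L2 \<Omega>. \<forall>m'\<in>L2 \<Omega>. (AE x in lebesgue_on \<Omega>. m x = m' x) \<longrightarrow>
        (AE x in lebesgue_on \<Omega>. F m x = F m' x))"

fun partials :: "'d list \<Rightarrow> (real^'d::finite \<Rightarrow> real) \<Rightarrow> real^'d \<Rightarrow> real" where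
  "partials [] \<phi> = \<phi>"
| "partials (i # is) \<phi> = (\<lambda>x. frechet_derivative (partials is \<phi>) (at x) (axis i 1))"

text \<open>\<open>C\<^sub>c\<^sup>\<infinity>(\<Omega>)\<close>, with functions extended by zero to the whole space.\<close>

definition test_functions :: "(real^'d::finite) set \<Rightarrow> (real^'d \<Rightarrow> real) set" where
  "test_functions \<Omega> = {\<phi>. (\<forall>is x. partials is \<phi> differentiable (at x)) \<and>
     compact (closure {x. \<phi> x \<noteq> 0}) \<and> closure {x. \<phi> x \<noteq> 0} \<subseteq> \<Omega>}"

text \<open>Used below only for \<open>v\<close> and \<open>g\<close> in \<open>L\<^sup>2(\<Omega>)\<close>, so that both integrands are integrable.\<close>

definition has_weak_deriv ::
  "(real^'d::finite) set \<Rightarrow> 'd list \<Rightarrow> (real^'d \<Rightarrow> real) \<Rightarrow> (real^'d \<Rightarrow> real) \<Rightarrow> bool" where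
  "has_weak_deriv \<Omega> is v g \<longleftrightarrow>
     (\<forall>\<phi>\<in>test_functions \<Omega>.
        (LINT x|lebesgue_on \<Omega>. v x * partials is \<phi> x) =
        (-1) ^ length is * (LINT x|lebesgue_on \<Omega>. g x * \<phi> x))"

text \<open>A representative of the weak derivative, which is unique up to equality a.e. in \<open>\<Omega>\<close>.\<close>

definition weak_deriv ::
  "(real^'d::finite) set \<Rightarrow> 'd list \<Rightarrow> (real^'d \<Rightarrow> real) \<Rightarrow> real^'d \<Rightarrow> real" where
  "weak_deriv \<Omega> is v = (SOME g. g \<in> L2 \<Omega> \<and> has_weak_deriv \<Omega> is v g)"

definition sobolev :: "nat \<Rightarrow> (real^'d::finite) set \<Rightarrow> (real^'d \<Rightarrow> real) set" where
  "sobolev k \<Omega> = {v \<in> L2 \<Omega>. \<forall>is. length is \<le> k \<longrightarrow> (\<exists>g\<in>L2 \<Omega>. has_weak_deriv \<Omega> is v g)}"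

definition sobolev_norm :: "nat \<Rightarrow> (real^'d::finite) set \<Rightarrow> (real^'d \<Rightarrow> real) \<Rightarrow> real" where
  "sobolev_norm k \<Omega> v =
     sqrt (\<Sum>is | length is \<le> k. L2_inner \<Omega> (weak_deriv \<Omega> is v) (weak_deriv \<Omega> is v))"

text \<open>\<open>H\<^sup>1\<^sub>0(\<Omega>)\<close> is the closure of the test functions in \<open>H\<^sup>1(\<Omega>)\<close>.\<close>

definition H10 :: "(real^'d::finite) set \<Rightarrow> (real^'d \<Rightarrow> real) set" where
  "H10 \<Omega> = {v \<in> sobolev 1 \<Omega>.
     \<forall>\<epsilon>>0. \<exists>\<phi>\<in>test_functions \<Omega>. sobolev_norm 1 \<Omega> (\<lambda>x. v x - \<phi> x) < \<epsilon>}"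

definition V_space :: "(real^'d::finite) set \<Rightarrow> (real^'d \<Rightarrow> real) set" where
  "V_space \<Omega> = sobolev 2 \<Omega> \<inter> H10 \<Omega>"

text \<open>
  Linearity and boundedness in the \<open>H\<^sup>2\<close> norm force a functional to depend only on the a.e. class
  of its argument.
\<close>

definition V_dual :: "(real^'d::finite) set \<Rightarrow> ((real^'d \<Rightarrow> real) \<Rightarrow> real) set" where
  "V_dual \<Omega> = {G.
     (\<forall>v\<in>V_space \<Omega>. \<forall>w\<in>V_space \<Omega>. G (\<lambda>x. v x + w x) = G v + G w) \<and>
     (\<forall>c. \<forall>v\<in>V_space \<Omega>. G (\<lambda>x. c * v x) = c * G v) \<and>
     (\<exists>C. \<forall>v\<in>V_space \<Omega>. \<bar>G v\<bar> \<le> C * sobolev_norm 2 \<Omega> v)}"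

definition weak_hessian :: "(real^'d::finite) set \<Rightarrow> (real^'d \<Rightarrow> real) \<Rightarrow> real^'d \<Rightarrow> real^'d^'d" where
  "weak_hessian \<Omega> v x = (\<chi> i j. weak_deriv \<Omega> [i, j] v x)"

definition hamiltonian ::
  "'a set \<Rightarrow> (real^'d::finite \<Rightarrow> 'a \<Rightarrow> real^'d^'d) \<Rightarrow> (real^'d \<Rightarrow> 'a \<Rightarrow> real) \<Rightarrow>
   real^'d \<Rightarrow> real^'d^'d \<Rightarrow> real" where
  "hamiltonian \<A> a f x M = (SUP \<alpha>\<in>\<A>. - a x \<alpha> \<bullet> M - f x \<alpha>)"

definition hamiltonian_op ::
  "(real^'d::finite) set \<Rightarrow> 'a set \<Rightarrow> (real^'d \<Rightarrow> 'a \<Rightarrow> real^'d^'d) \<Rightarrow> (real^'d \<Rightarrow> 'a \<Rightarrow> real) \<Rightarrow>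
   (real^'d \<Rightarrow> real) \<Rightarrow> real^'d \<Rightarrow> real" where
  "hamiltonian_op \<Omega> \<A> a f v x = hamiltonian \<A> a f x (weak_hessian \<Omega> v x)"

definition partial_subdiff ::
  "'a set \<Rightarrow> (real^'d::finite \<Rightarrow> 'a \<Rightarrow> real^'d^'d) \<Rightarrow> (real^'d \<Rightarrow> 'a \<Rightarrow> real) \<Rightarrow>
   real^'d \<Rightarrow> real^'d^'d \<Rightarrow> (real^'d^'d) set" where
  "partial_subdiff \<A> a f x M = {A \<in> sym_matrices.
     \<forall>M'\<in>sym_matrices. hamiltonian \<A> a f x M + A \<bullet> (M' - M) \<le> hamiltonian \<A> a f x M'}"

definition DH ::
  "(real^'d::finite) set \<Rightarrow> 'a set \<Rightarrow> (real^'d \<Rightarrow> 'a \<Rightarrow> real^'d^'d) \<Rightarrow> (real^'d \<Rightarrow> 'a \<Rightarrow> real) \<Rightarrow>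
   (real^'d \<Rightarrow> real) \<Rightarrow> (real^'d \<Rightarrow> real^'d^'d) set" where
  "DH \<Omega> \<A> a f v = {A \<in> Linfty_sym \<Omega>.
     AE x in lebesgue_on \<Omega>. A x \<in> partial_subdiff \<A> a f x (weak_hessian \<Omega> v x)}"

definition PDI_solution ::
  "(real^'d::finite) set \<Rightarrow> 'a set \<Rightarrow> (real^'d \<Rightarrow> 'a \<Rightarrow> real^'d^'d) \<Rightarrow> (real^'d \<Rightarrow> 'a \<Rightarrow> real) \<Rightarrow>
   ((real^'d \<Rightarrow> real) \<Rightarrow> (real^'d \<Rightarrow> real)) \<Rightarrow> ((real^'d \<Rightarrow> real) \<Rightarrow> real) \<Rightarrow>
   (real^'d \<Rightarrow> real) \<Rightarrow> (real^'d \<Rightarrow> real) \<Rightarrow> bool" where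
  "PDI_solution \<Omega> \<A> a f F G u m \<longleftrightarrow>
     u \<in> V_space \<Omega> \<and> m \<in> L2 \<Omega> \<and>
     (AE x in lebesgue_on \<Omega>. hamiltonian_op \<Omega> \<A> a f u x = F m x) \<and>
     (\<exists>abar. (\<lambda>x. - abar x) \<in> DH \<Omega> \<A> a f u \<and>
        (\<forall>v\<in>V_space \<Omega>. L2_inner \<Omega> m (\<lambda>x. - abar x \<bullet> weak_hessian \<Omega> v x) = G v))"

definition VI_solution ::
  "(real^'d::finite) set \<Rightarrow> 'a set \<Rightarrow> (real^'d \<Rightarrow> 'a \<Rightarrow> real^'d^'d) \<Rightarrow> (real^'d \<Rightarrow> 'a \<Rightarrow> real) \<Rightarrow>
   ((real^'d \<Rightarrow> real) \<Rightarrow> (real^'d \<Rightarrow> real)) \<Rightarrow> ((real^'d \<Rightarrow> real) \<Rightarrow> real) \<Rightarrow>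
   (real^'d \<Rightarrow> real) \<Rightarrow> (real^'d \<Rightarrow> real) \<Rightarrow> bool" where
  "VI_solution \<Omega> \<A> a f F G u m \<longleftrightarrow>
     u \<in> V_space \<Omega> \<and> m \<in> L2_nonneg \<Omega> \<and>
     (AE x in lebesgue_on \<Omega>. hamiltonian_op \<Omega> \<A> a f u x = F m x) \<and>
     (\<forall>v\<in>V_space \<Omega>. G (\<lambda>x. v x - u x) \<le>
        L2_inner \<Omega> m (\<lambda>x. hamiltonian_op \<Omega> \<A> a f v x - hamiltonian_op \<Omega> \<A> a f u x))"

end

theory Submission
  imports Defs "HOL-Library.Function_Algebras"
begin

text \<open>
  A solution of the partial differential inclusion is one of the variational inequality by the
  definition of the subdifferential, multiplied by \<open>m \<ge> 0\<close> and integrated.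

  For the converse, testing the variational inequality with \<open>u + t w\<close> and letting \<open>t\<close> tend to \<open>0\<close>
  shows that the functional \<open>m D\<^sup>2w \<mapsto> \<langle>G, w\<rangle>\<close> is dominated by
  \<open>\<Phi>(W) = \<integral> H(x, D\<^sup>2u + W) - H(x, D\<^sup>2u) dx\<close>, a convex Lipschitz functional on \<open>L\<^sup>1(\<Omega>)\<close>. The theorem
  of Hahn and Banach extends it to a functional on \<open>L\<^sup>1(\<Omega>)\<close> dominated by \<open>\<Phi>\<close>, which is given by some
  \<open>A\<close> in \<open>L\<^sup>\<infinity>(\<Omega>)\<close>. Testing with matrices that are constant on a measurable set gives
  \<open>A(x) \<in> \<partial>\<^sub>M H(x, D\<^sup>2u(x))\<close> almost everywhere, also where \<open>m\<close> vanishes, so that no measurable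
  selection theorem is needed.
\<close>

subsection \<open>A theorem of Hahn and Banach with a convex majorant\<close>

text \<open>The increment of H is convex but not positively homogeneous in the perturbation, hence a
  Hahn-Banach theorem whose majorant is merely convex. The extension takes place in L^1 because m
  and D^2 w are only in L^2: their product is in L^1, and the dual of L^1 delivers the bounded A
  that membership in \<open>DH\<close> demands. The obstacle in the limit t to 0 is that m varies
  without upper or positive lower bound: with X = D^2 u and W = D^2 w, the estimate m (H(X + t W) -
  H(X)) <= t (H(X + m W) - H(X)) comes from convexity only where m >= t. Elsewhere the Lipschitz
  bound leaves an error of order t^2, which still vanishes after division by t. The assignment of G
  w to m D^2 w is not known in advance to be well defined, so functionals are treated as graphs. The
  extension sees all matrices, so the symmetry of A has to be recovered from the fact that H ignores
  antisymmetric perturbations. Weak derivatives are chosen representatives; their linearity and the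
  symmetry of the Hessian hold almost everywhere and rest on the fundamental lemma of the calculus
  of variations.\<close>

instantiation "fun" :: (type, real_vector) real_vector
begin

text \<open>With pointwise scaling, functions into a real vector space form one themselves, so that
  \<open>subspace\<close> and \<open>convex_on\<close> apply to integrable functions and to graphs
  of functionals on them.\<close>

definition scaleR_fun :: "real \<Rightarrow> ('a \<Rightarrow> 'b) \<Rightarrow> 'a \<Rightarrow> 'b" where
  "scaleR_fun c f = (\<lambda>x. c *\<^sub>R f x)"

instance
  by standard (auto simp: scaleR_fun_def fun_eq_iff algebra_simps)

end

lemma exists_separating_real:
  fixes P Q :: "real set"
  assumes "P \<noteq> {}" "Q \<noteq> {}" and le: "\<And>x y. x \<in> P \<Longrightarrow> y \<in> Q \<Longrightarrow> x \<le> y"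
  obtains c where "\<And>x. x \<in> P \<Longrightarrow> x \<le> c" "\<And>y. y \<in> Q \<Longrightarrow> c \<le> y"
proof
  have bdd: "bdd_above P"
    using assms by (meson bdd_aboveI ex_in_conv)
  show "x \<le> Sup P" if "x \<in> P" for x
    using bdd that by (rule cSup_upper[rotated])
  show "Sup P \<le> y" if "y \<in> Q" for y
    using \<open>P \<noteq> {}\<close> le that by (intro cSup_least)
qed

text \<open>The number c is the value of the extension at z. The conditions with k < 0 bound c below
  by the elements of \<open>P\<close>, those with k > 0 bound it above by the elements of
  \<open>Q\<close>. Every k has to be kept, since p is in general not positively homogeneous and no
  scaling to k = 1 or k = -1 is possible. Convexity of p places \<open>P\<close> below
  \<open>Q\<close>.\<close>

lemma Hahn_Banach_step:
  fixes \<Gamma> :: "('v::real_vector \<times> real) set"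
  assumes E: "subspace E" and p: "convex_on E p" and \<Gamma>: "subspace \<Gamma>"
    and below: "\<And>v r. (v, r) \<in> \<Gamma> \<Longrightarrow> v \<in> E \<and> r \<le> p v"
    and z: "z \<in> E"
  obtains c where "\<And>v r k. (v, r) \<in> \<Gamma> \<Longrightarrow> r + k * c \<le> p (v + k *\<^sub>R z)"
proof -
  define P where "P = {(r - p (v - k *\<^sub>R z)) / k | v r k. (v, r) \<in> \<Gamma> \<and> k > 0}"
  define Q where "Q = {(p (v + k *\<^sub>R z) - r) / k | v r k. (v, r) \<in> \<Gamma> \<and> k > 0}"
  have zero: "(0, 0) \<in> \<Gamma>"
    using subspace_0[OF \<Gamma>] by (simp add: zero_prod_def)
  have "(0 - p (0 - 1 *\<^sub>R z)) / 1 \<in> P" "(p (0 + 1 *\<^sub>R z) - 0) / 1 \<in> Q"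
    unfolding P_def Q_def using zero zero_less_one by blast+
  then have ne: "P \<noteq> {}" "Q \<noteq> {}" by blast+
  have "x \<le> y" if xP: "x \<in> P" and yQ: "y \<in> Q" for x y
  proof -
    obtain v r k where x: "x = (r - p (v - k *\<^sub>R z)) / k" "(v, r) \<in> \<Gamma>" "k > 0"
      using xP unfolding P_def by blast
    obtain w s l where y: "y = (p (w + l *\<^sub>R z) - s) / l" "(w, s) \<in> \<Gamma>" "l > 0"
      using yQ unfolding Q_def by blast
    \<comment> \<open>The weight balances the two shifts, (1 - \<theta>) k = \<theta> l, so that the
      multiples of z cancel and the convex combination falls into the domain of \<Gamma>.\<close>
    define \<theta> where "\<theta> = k / (k + l)"
    have \<theta>: "0 \<le> \<theta>" "\<theta> \<le> 1" "1 - \<theta> = l / (k + l)" "(1 - \<theta>) * k = \<theta> * l"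
      using x y by (auto simp: \<theta>_def field_simps)
    have "(1 - \<theta>) *\<^sub>R (v, r) + \<theta> *\<^sub>R (w, s) \<in> \<Gamma>"
      using \<Gamma> x y by (intro subspace_add subspace_scale)
    then have "(1 - \<theta>) * r + \<theta> * s \<le> p ((1 - \<theta>) *\<^sub>R v + \<theta> *\<^sub>R w)"
      using below by fastforce
    also have "(1 - \<theta>) *\<^sub>R v + \<theta> *\<^sub>R w = (1 - \<theta>) *\<^sub>R (v - k *\<^sub>R z) + \<theta> *\<^sub>R (w + l *\<^sub>R z)"
      using \<theta>(4) by (simp add: algebra_simps flip: scaleR_left_distrib)
    also have "p \<dots> \<le> (1 - \<theta>) * p (v - k *\<^sub>R z) + \<theta> * p (w + l *\<^sub>R z)"
      using below[OF x(2)] below[OF y(2)] E z \<theta>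
      by (intro convex_onD[OF p]) (auto intro: subspace_add subspace_diff subspace_scale)
    finally have "(1 - \<theta>) * (r - p (v - k *\<^sub>R z)) \<le> \<theta> * (p (w + l *\<^sub>R z) - s)"
      by (simp add: algebra_simps)
    then have "l * (r - p (v - k *\<^sub>R z)) \<le> k * (p (w + l *\<^sub>R z) - s)"
      unfolding \<theta>(3) unfolding \<theta>_def using x y by (simp add: divide_simps)
    then show ?thesis
      unfolding x(1) y(1) using x(3) y(3) by (simp add: divide_simps mult.commute)
  qed
  then obtain c where c: "\<And>x. x \<in> P \<Longrightarrow> x \<le> c" "\<And>y. y \<in> Q \<Longrightarrow> c \<le> y"
    using exists_separating_real ne by metis
  have "r + k * c \<le> p (v + k *\<^sub>R z)" if vr: "(v, r) \<in> \<Gamma>" for v r k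
  proof (cases k "0::real" rule: linorder_cases)
    case less
    then have "(r - p (v - (- k) *\<^sub>R z)) / (- k) \<in> P"
      unfolding P_def using vr neg_0_less_iff_less by blast
    from c(1)[OF this] show ?thesis
      using less by (simp add: field_simps)
  next
    case equal
    then show ?thesis using below[OF vr] by simp
  next
    case greater
    then have "(p (v + k *\<^sub>R z) - r) / k \<in> Q"
      unfolding Q_def using vr by blast
    from c(2)[OF this] show ?thesis
      using greater by (simp add: field_simps)
  qed
  then show ?thesis by (rule that)
qed

text \<open>
  The graph of a linear functional dominated by \<open>p\<close> is a subspace of \<open>V \<times> \<real>\<close> below the graph of
  \<open>p\<close>. Conversely such a subspace is automatically single valued, because \<open>(0, r)\<close> can be scaled.
\<close>

theorem Hahn_Banach_convex:
  fixes \<Gamma> :: "('v::real_vector \<times> real) set"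
  assumes E: "subspace E" and p: "convex_on E p" and \<Gamma>: "subspace \<Gamma>"
    and below: "\<And>v r. (v, r) \<in> \<Gamma> \<Longrightarrow> v \<in> E \<and> r \<le> p v"
  obtains L where "\<And>v. v \<in> E \<Longrightarrow> L v \<le> p v"
    and "\<And>v w. v \<in> E \<Longrightarrow> w \<in> E \<Longrightarrow> L (v + w) = L v + L w"
    and "\<And>c v. v \<in> E \<Longrightarrow> L (c *\<^sub>R v) = c * L v"
    and "\<And>v r. (v, r) \<in> \<Gamma> \<Longrightarrow> L v = r"
proof -
  define \<A> where "\<A> = {\<Delta>. subspace \<Delta> \<and> \<Gamma> \<subseteq> \<Delta> \<and> (\<forall>v r. (v, r) \<in> \<Delta> \<longrightarrow> v \<in> E \<and> r \<le> p v)}"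
  have "\<exists>M\<in>\<A>. \<forall>X\<in>\<A>. M \<subseteq> X \<longrightarrow> X = M"
  proof (rule subset_Zorn_nonempty)
    show "\<A> \<noteq> {}" using \<Gamma> below unfolding \<A>_def by blast
    fix \<C> assume ne: "\<C> \<noteq> {}" and ch: "subset.chain \<A> \<C>"
    then have sub: "\<C> \<subseteq> \<A>" and lin: "\<And>X Y. X \<in> \<C> \<Longrightarrow> Y \<in> \<C> \<Longrightarrow> X \<subseteq> Y \<or> Y \<subseteq> X"
      by (auto simp: subset.chain_def)
    have "subspace (\<Union>\<C>)"
    proof (rule subspaceI)
      show "0 \<in> \<Union>\<C>" using ne sub subspace_0 unfolding \<A>_def by blast
      show "x + y \<in> \<Union>\<C>" if xy: "x \<in> \<Union>\<C>" "y \<in> \<Union>\<C>" for x y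
      proof -
        obtain X Y where "X \<in> \<C>" "Y \<in> \<C>" "x \<in> X" "y \<in> Y" using xy by blast
        then obtain Z where "Z \<in> \<C>" "x \<in> Z" "y \<in> Z" using lin by blast
        then show ?thesis using sub unfolding \<A>_def by (auto intro: subspace_add)
      qed
      show "c *\<^sub>R x \<in> \<Union>\<C>" if "x \<in> \<Union>\<C>" for c x
        using that sub unfolding \<A>_def by (auto intro: subspace_scale)
    qed
    then show "\<Union>\<C> \<in> \<A>" using ne sub unfolding \<A>_def by blast
  qed
  then obtain M where M: "M \<in> \<A>" and max: "\<And>X. X \<in> \<A> \<Longrightarrow> M \<subseteq> X \<Longrightarrow> X = M" by blast
  have sM: "subspace M" and \<Gamma>M: "\<Gamma> \<subseteq> M" and bM: "\<And>v r. (v, r) \<in> M \<Longrightarrow> v \<in> E \<and> r \<le> p v"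
    using M unfolding \<A>_def by blast+
  have single: "r = s" if "(v, r) \<in> M" "(v, s) \<in> M" for v r s
  proof (rule ccontr)
    assume "r \<noteq> s"
    have "((\<bar>p 0\<bar> + 1) / (r - s)) *\<^sub>R ((v, r) - (v, s)) \<in> M"
      using that sM by (intro subspace_scale subspace_diff)
    then have "\<bar>p 0\<bar> + 1 \<le> p 0" using bM \<open>r \<noteq> s\<close> by fastforce
    then show False by linarith
  qed
  have total: "\<exists>r. (z, r) \<in> M" if z: "z \<in> E" for z
  proof -
    obtain c where c: "\<And>v r k. (v, r) \<in> M \<Longrightarrow> r + k * c \<le> p (v + k *\<^sub>R z)"
      using Hahn_Banach_step[OF E p sM bM z] by blast
    \<comment> \<open>\<open>N\<close> is the graph extended by the value c at z; maximality
      identifies it with \<open>M\<close>, so z was already in the domain.\<close>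
    define N where "N = {x + y | x y. x \<in> M \<and> y \<in> span {(z, c)}}"
    have "subspace N" unfolding N_def using sM by (intro subspace_sums subspace_span)
    moreover have MN: "M \<subseteq> N"
    proof
      fix x assume "x \<in> M"
      then have "x + 0 \<in> N" unfolding N_def using span_zero by blast
      then show "x \<in> N" by simp
    qed
    moreover have "v \<in> E \<and> r \<le> p v" if "(v, r) \<in> N" for v r
    proof -
      obtain v' r' k where "(v', r') \<in> M" "v = v' + k *\<^sub>R z" "r = r' + k * c"
        using \<open>(v, r) \<in> N\<close> unfolding N_def span_singleton by auto
      then show ?thesis
        using c bM E z by (auto intro: subspace_add subspace_scale)
    qed
    ultimately have "N = M" using \<Gamma>M by (intro max) (auto simp: \<A>_def)
    moreover have "0 + (z, c) \<in> N"
      unfolding N_def using subspace_0[OF sM] by (blast intro: span_base)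
    ultimately show ?thesis by auto
  qed
  define L where "L v = (THE r. (v, r) \<in> M)" for v
  have L_eq: "L v = r" if "(v, r) \<in> M" for v r
    unfolding L_def using that single by blast
  have L: "(v, L v) \<in> M" if "v \<in> E" for v
    using total[OF that] L_eq by blast
  show ?thesis
  proof (rule that)
    show "L v \<le> p v" if "v \<in> E" for v using L[OF that] bM by blast
    show "L (v + w) = L v + L w" if "v \<in> E" "w \<in> E" for v w
      using subspace_add[OF sM L[OF that(1)] L[OF that(2)]] by (intro L_eq) simp
    show "L (c *\<^sub>R v) = c * L v" if "v \<in> E" for c v
      using subspace_scale[OF sM L[OF that], of c] by (intro L_eq) simp
    show "L v = r" if "(v, r) \<in> \<Gamma>" for v r using that \<Gamma>M by (intro L_eq) blast
  qed
qed

subsection \<open>The dual of \<open>L\<^sup>1\<close>\<close>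

text \<open>Testing with the set where g is negative gives an integral that is both nonnegative and
  nonpositive, so this set is null.\<close>

lemma AE_nonneg_if_set_integrals_nonneg:
  fixes g :: "'a \<Rightarrow> real"
  assumes g: "integrable M g"
    and nn: "\<And>E. E \<in> sets M \<Longrightarrow> 0 \<le> (LINT x|M. indicator E x * g x)"
  shows "AE x in M. 0 \<le> g x"
proof -
  have meas[measurable]: "g \<in> borel_measurable M" using g by (rule borel_measurable_integrable)
  define E where "E = {x \<in> space M. g x < 0}"
  have E[measurable]: "E \<in> sets M" unfolding E_def by measurable
  have int: "integrable M (\<lambda>x. - (indicator E x * g x))"
    using integrable_mult_indicator[OF E g] by simp
  have ge: "AE x in M. 0 \<le> - (indicator E x * g x)"
    by (auto simp: E_def indicator_def)
  have "(LINT x|M. - (indicator E x * g x)) = 0"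
    using nn[OF E] integral_nonneg_AE[OF ge] by simp
  then have "AE x in M. - (indicator E x * g x) = 0"
    using integral_nonneg_eq_0_iff_AE[OF int ge] by simp
  then show ?thesis
    using AE_space by eventually_elim (auto simp: E_def indicator_def split: if_splits)
qed

lemma AE_bounds_if_set_integrals_bounded:
  fixes g :: "'a \<Rightarrow> real"
  assumes "finite_measure M" and g: "integrable M g"
    and bd: "\<And>E. E \<in> sets M \<Longrightarrow> \<bar>LINT x|M. indicator E x * g x\<bar> \<le> C * measure M E"
  shows "AE x in M. \<bar>g x\<bar> \<le> C"
proof -
  interpret finite_measure M by fact
  have "AE x in M. 0 \<le> C - g x" "AE x in M. 0 \<le> C + g x"
  proof -
    have ig: "integrable M (\<lambda>x. indicator E x * g x)" "integrable M (\<lambda>x. indicator E x * C)"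
      "(LINT x|M. indicator E x * C) = C * measure M E"
      if "E \<in> sets M" for E
      using integrable_mult_indicator[OF that g] that sets.sets_into_space[OF that]
      by (auto simp: less_top[symmetric] Int_absorb2)
    show "AE x in M. 0 \<le> C - g x"
    proof (rule AE_nonneg_if_set_integrals_nonneg)
      fix E assume E: "E \<in> sets M"
      have "(LINT x|M. indicator E x * (C - g x)) = C * measure M E - (LINT x|M. indicator E x * g x)"
        unfolding right_diff_distrib Bochner_Integration.integral_diff[OF ig(2,1)[OF E]] ig(3)[OF E] ..
      then show "0 \<le> (LINT x|M. indicator E x * (C - g x))"
        using bd[OF E] by linarith
    qed (use g in auto)
    show "AE x in M. 0 \<le> C + g x"
    proof (rule AE_nonneg_if_set_integrals_nonneg)
      fix E assume E: "E \<in> sets M"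
      have "(LINT x|M. indicator E x * (C + g x)) = C * measure M E + (LINT x|M. indicator E x * g x)"
        unfolding distrib_left Bochner_Integration.integral_add[OF ig(2,1)[OF E]] ig(3)[OF E] ..
      then show "0 \<le> (LINT x|M. indicator E x * (C + g x))"
        using bd[OF E] by linarith
    qed (use g in auto)
  qed
  then show ?thesis by eventually_elim auto
qed

text \<open>
  Adding a multiple of \<open>M\<close> makes the set function \<open>E \<mapsto> T (indicator E)\<close> nonnegative, so that the
  theorem of Radon and Nikodym for positive measures applies without a Jordan decomposition.
\<close>

lemma L1_dual_density:
  fixes T :: "('a \<Rightarrow> real) \<Rightarrow> real"
  assumes "finite_measure M"
    and add: "\<And>f g. integrable M f \<Longrightarrow> integrable M g \<Longrightarrow> T (\<lambda>x. f x + g x) = T f + T g"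
    and scale: "\<And>c f. integrable M f \<Longrightarrow> T (\<lambda>x. c * f x) = c * T f"
    and bound: "\<And>f. integrable M f \<Longrightarrow> \<bar>T f\<bar> \<le> C * (LINT x|M. \<bar>f x\<bar>)"
  obtains g where "integrable M g"
    and "\<And>E. E \<in> sets M \<Longrightarrow> T (indicator E) = (LINT x|M. indicator E x * g x)"
proof -
  interpret finite_measure M by fact
  have int_ind: "integrable M (indicator E :: _ \<Rightarrow> real)" if "E \<in> sets M" for E
    using that by (simp add: less_top[symmetric])
  have bd: "\<bar>T (indicator E)\<bar> \<le> C * measure M E" if "E \<in> sets M" for E
    using bound[OF int_ind[OF that]] that by simp
  define \<nu> where "\<nu> E = T (indicator E) + C * measure M E" for E
  have \<nu>0: "0 \<le> \<nu> E" and \<nu>le: "\<nu> E \<le> 2 * C * measure M E" if "E \<in> sets M" for E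
    using bd[OF that] unfolding \<nu>_def by auto
  have T0: "T (\<lambda>x. 0) = 0" using scale[of "\<lambda>x. 0" 0] by simp
  have ind_empty: "indicator {} = (\<lambda>x. 0 :: real)" by (simp add: fun_eq_iff)
  have "T (indicator {}) = 0" unfolding ind_empty by (rule T0)
  then have \<nu>_empty: "\<nu> {} = 0" by (simp add: \<nu>_def)
  have \<nu>_add: "\<nu> (A \<union> B) = \<nu> A + \<nu> B" if "A \<in> sets M" "B \<in> sets M" "A \<inter> B = {}" for A B
  proof -
    have "indicator (A \<union> B) = (\<lambda>x. indicator A x + indicator B x :: real)"
      using that by (auto simp: indicator_def fun_eq_iff)
    then have "T (indicator (A \<union> B)) = T (indicator A) + T (indicator B)"
      using add[OF int_ind[OF that(1)] int_ind[OF that(2)]] by simp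
    moreover have "measure M (A \<union> B) = measure M A + measure M B"
      using that by (intro finite_measure_Union) auto
    ultimately show ?thesis by (simp add: \<nu>_def distrib_left)
  qed
  define N where "N = measure_of (space M) (sets M) (\<lambda>E. ennreal (\<nu> E))"
  have pos: "positive (sets M) (\<lambda>E. ennreal (\<nu> E))"
    by (simp add: positive_def \<nu>_empty)
  \<comment> \<open>For a finite additive set function, countable additivity amounts to continuity
    at the empty set, and this is inherited from M through the bound \<nu> <= 2 C M.\<close>
  have "countably_additive (sets M) (\<lambda>E. ennreal (\<nu> E))"
  proof (rule sets.empty_continuous_imp_countably_additive[OF pos])
    show "additive (sets M) (\<lambda>E. ennreal (\<nu> E))"
      unfolding additive_def using \<nu>_add \<nu>0 by (auto simp: ennreal_plus)
    show "\<forall>A\<in>sets M. ennreal (\<nu> A) \<noteq> \<infinity>" by simp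
    fix A :: "nat \<Rightarrow> 'a set"
    assume A: "range A \<subseteq> sets M" "decseq A" "(\<Inter>i. A i) = {}"
    have "(\<lambda>i. measure M (A i)) \<longlonglongrightarrow> measure M (\<Inter>i. A i)"
      using A by (intro finite_Lim_measure_decseq)
    then have "(\<lambda>i. 2 * C * measure M (A i)) \<longlonglongrightarrow> 2 * C * 0"
      using A(3) by (intro tendsto_intros) simp
    then have lim: "(\<lambda>i. 2 * C * measure M (A i)) \<longlonglongrightarrow> 0" by simp
    have "(\<lambda>i. \<nu> (A i)) \<longlonglongrightarrow> 0"
      by (rule tendsto_sandwich[OF _ _ tendsto_const lim]) (use A \<nu>0 \<nu>le in auto)
    then show "(\<lambda>i. ennreal (\<nu> (A i))) \<longlonglongrightarrow> 0"
      using tendsto_ennrealI by fastforce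
  qed
  then have emN: "emeasure N E = ennreal (\<nu> E)" if "E \<in> sets M" for E
    unfolding N_def using pos that by (intro emeasure_measure_of_sigma sets.sigma_algebra_axioms)
  have setsN: "sets N = sets M"
    unfolding N_def by (simp add: sets.sets_measure_of_eq)
  have "absolutely_continuous M N"
    unfolding absolutely_continuous_def null_sets_def
  proof safe
    fix E assume E: "E \<in> sets M" "emeasure M E = 0"
    then have "\<nu> E = 0" using \<nu>0[of E] \<nu>le[of E] by (simp add: measure_def)
    then show "emeasure N E = 0" using emN E by simp
  qed (simp add: setsN)
  then obtain h where h[measurable]: "h \<in> borel_measurable M" and hN: "density M h = N"
    using Radon_Nikodym setsN by blast
  have h_int: "(\<integral>\<^sup>+x. h x * indicator E x \<partial>M) = ennreal (\<nu> E)" if "E \<in> sets M" for E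
    using emeasure_density[OF h that] hN emN[OF that] by simp
  have hfin: "(\<integral>\<^sup>+x. h x \<partial>M) \<noteq> \<infinity>"
  proof -
    have "(\<integral>\<^sup>+x. h x \<partial>M) = (\<integral>\<^sup>+x. h x * indicator (space M) x \<partial>M)"
      by (intro nn_integral_cong) simp
    then show ?thesis using h_int[of "space M"] by simp
  qed
  \<comment> \<open>The density is finite almost everywhere because its total integral, the value of
    \<nu> on \<open>space M\<close>, is a real number.\<close>
  define g where "g x = enn2real (h x)" for x
  have g[measurable]: "g \<in> borel_measurable M" unfolding g_def by measurable
  have hg: "AE x in M. h x = ennreal (g x)"
    using nn_integral_PInf_AE[OF h hfin] by eventually_elim (auto simp: g_def less_top)
  have g_nn: "(\<integral>\<^sup>+x. ennreal (indicator E x * g x) \<partial>M) = ennreal (\<nu> E)" if "E \<in> sets M" for E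
  proof -
    have "AE x in M. ennreal (indicator E x * g x) = h x * indicator E x"
      using hg by eventually_elim (simp add: indicator_def)
    then have "(\<integral>\<^sup>+x. ennreal (indicator E x * g x) \<partial>M) = (\<integral>\<^sup>+x. h x * indicator E x \<partial>M)"
      by (rule nn_integral_cong_AE)
    then show ?thesis using h_int[OF that] by simp
  qed
  have g_int: "(LINT x|M. indicator E x * g x) = \<nu> E" "integrable M (\<lambda>x. indicator E x * g x)"
    if "E \<in> sets M" for E
  proof -
    have "has_bochner_integral M (\<lambda>x. indicator E x * g x) (\<nu> E)"
      using that \<nu>0[OF that] g_nn[OF that]
      by (intro has_bochner_integral_nn_integral) (auto simp: g_def)
    then show "(LINT x|M. indicator E x * g x) = \<nu> E" "integrable M (\<lambda>x. indicator E x * g x)"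
      by (auto simp: has_bochner_integral_iff)
  qed
  have gi: "integrable M g"
    using g_int(2)[of "space M"] by (simp cong: Bochner_Integration.integrable_cong)
  show ?thesis
  proof (rule that)
    \<comment> \<open>Subtracting C undoes the shift built into \<nu>.\<close>
    show "integrable M (\<lambda>x. g x - C)" using gi by simp
    fix E assume E: "E \<in> sets M"
    have "(LINT x|M. indicator E x * (g x - C)) = \<nu> E - (LINT x|M. indicator E x * C)"
      using g_int[OF E] int_ind[OF E] by (simp add: right_diff_distrib)
    then show "T (indicator E) = (LINT x|M. indicator E x * (g x - C))"
      using E by (simp add: \<nu>_def)
  qed
qed

text \<open>Both sides are continuous in the L^1 norm, so agreement on indicators extends to
  integrable functions by linearity and approximation by simple functions.\<close>

lemma L1_dual_representation_real:
  fixes T :: "('a \<Rightarrow> real) \<Rightarrow> real"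
  assumes fin: "finite_measure M"
    and add: "\<And>f g. integrable M f \<Longrightarrow> integrable M g \<Longrightarrow> T (\<lambda>x. f x + g x) = T f + T g"
    and scale: "\<And>c f. integrable M f \<Longrightarrow> T (\<lambda>x. c * f x) = c * T f"
    and bound: "\<And>f. integrable M f \<Longrightarrow> \<bar>T f\<bar> \<le> C * (LINT x|M. \<bar>f x\<bar>)"
  obtains g where "g \<in> borel_measurable M" "\<And>x. \<bar>g x\<bar> \<le> \<bar>C\<bar>"
    and "\<And>f. integrable M f \<Longrightarrow> T f = (LINT x|M. g x * f x)"
proof -
  interpret finite_measure M by fact
  obtain g0 where g0: "integrable M g0"
    and T_g0: "\<And>E. E \<in> sets M \<Longrightarrow> T (indicator E) = (LINT x|M. indicator E x * g0 x)"
    using L1_dual_density[OF assms] by blast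
  have g0_le: "AE x in M. \<bar>g0 x\<bar> \<le> C"
  proof (rule AE_bounds_if_set_integrals_bounded[OF fin g0])
    fix E assume E: "E \<in> sets M"
    have "integrable M (indicator E :: _ \<Rightarrow> real)" using E by (simp add: less_top[symmetric])
    then show "\<bar>LINT x|M. indicator E x * g0 x\<bar> \<le> C * measure M E"
      using bound[of "indicator E"] T_g0[OF E] E by simp
  qed
  \<comment> \<open>The bound for \<open>g0\<close> holds almost everywhere; truncation makes it
    hold at every point. The absolute value keeps the two truncation levels in order whatever the
    sign of C.\<close>
  define g where "g x = max (- \<bar>C\<bar>) (min \<bar>C\<bar> (g0 x))" for x
  have g0m[measurable]: "g0 \<in> borel_measurable M" using g0 by simp
  have g[measurable]: "g \<in> borel_measurable M" unfolding g_def by measurable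
  have g_le: "\<bar>g x\<bar> \<le> \<bar>C\<bar>" for x unfolding g_def by auto
  have gg0: "AE x in M. g x = g0 x"
    using g0_le by eventually_elim (auto simp: g_def)
  have g_int: "integrable M (\<lambda>x. g x * f x)" if "integrable M f" for f :: "'a \<Rightarrow> real"
  proof (rule Bochner_Integration.integrable_bound)
    show "integrable M (\<lambda>x. \<bar>C\<bar> * f x)" using that by simp
    show "AE x in M. norm (g x * f x) \<le> norm (\<bar>C\<bar> * f x)"
      using g_le by (auto simp: abs_mult intro!: mult_right_mono)
  qed (use that in measurable)
  have "T f = (LINT x|M. g x * f x)" if "integrable M f" for f
    using that
  proof induct
    case (base E c)
    note base(1)[measurable]
    have ae: "AE x in M. indicator E x * g0 x = indicator E x * g x"
      using gg0 by eventually_elim simp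
    have T_g: "T (indicator E) = (LINT x|M. indicator E x * g x)"
      unfolding T_g0[OF base(1)] by (intro integral_cong_AE ae) measurable
    have "integrable M (indicator E :: _ \<Rightarrow> real)" using base by simp
    then have "T (\<lambda>x. indicator E x * c) = c * T (indicator E)"
      using scale[of "indicator E" c] by (simp add: mult.commute)
    also note T_g
    also have "c * (LINT x|M. indicator E x * g x) = (LINT x|M. c * (indicator E x * g x))"
      by simp
    also have "\<dots> = (LINT x|M. g x * (indicator E x *\<^sub>R c))"
      by (intro Bochner_Integration.integral_cong) auto
    finally show ?case by simp
  next
    case (add f h)
    then show ?case
      using g_int[of f] g_int[of h] assms(2) by (simp add: distrib_left)
  next
    case (lim f s)
    have intd: "integrable M (\<lambda>x. s i x - f x)" for i using lim by simp
    have f[measurable]: "f \<in> borel_measurable M" and s[measurable]: "\<And>i. s i \<in> borel_measurable M"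
      using lim by auto
    have L1: "(\<lambda>i. LINT x|M. \<bar>s i x - f x\<bar>) \<longlonglongrightarrow> (LINT x|M. 0)"
    proof (rule integral_dominated_convergence)
      \<comment> \<open>The approximating functions satisfy |s i| <= 2 |f|, whence the factor 3 for
        the difference.\<close>
      show "integrable M (\<lambda>x. 3 * \<bar>f x\<bar>)" using lim by simp
      show "AE x in M. (\<lambda>i. \<bar>s i x - f x\<bar>) \<longlonglongrightarrow> 0"
        using lim(3) by (intro AE_I2 tendsto_rabs_zero LIM_zero) auto
      show "AE x in M. norm \<bar>s i x - f x\<bar> \<le> 3 * \<bar>f x\<bar>" for i
        
      proof (intro AE_I2)
        fix x assume "x \<in> space M"
        then have "\<bar>s i x\<bar> \<le> 2 * \<bar>f x\<bar>" using lim(4) by simp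
        then show "norm \<bar>s i x - f x\<bar> \<le> 3 * \<bar>f x\<bar>" by simp
      qed
    qed measurable
    have diffT: "T (s i) - T f = T (\<lambda>x. s i x - f x)" for i
      using add[of "\<lambda>x. s i x - f x" f] intd lim(5) by simp
    have cmp: "norm (T (s i) - T f) \<le> C * (LINT x|M. \<bar>s i x - f x\<bar>)" for i
      unfolding diffT real_norm_def using bound intd by blast
    have null: "(\<lambda>i. C * (LINT x|M. \<bar>s i x - f x\<bar>)) \<longlonglongrightarrow> 0"
      using tendsto_mult_right_zero[OF L1[simplified]] .
    have "(\<lambda>i. T (s i) - T f) \<longlonglongrightarrow> 0"
      using cmp by (intro Lim_null_comparison[OF always_eventually null]) (rule allI)
    then have lim1: "(\<lambda>i. T (s i)) \<longlonglongrightarrow> T f" by (simp add: LIM_zero_iff)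
    have lim2: "(\<lambda>i. LINT x|M. g x * s i x) \<longlonglongrightarrow> (LINT x|M. g x * f x)"
    proof (rule integral_dominated_convergence)
      show "integrable M (\<lambda>x. \<bar>C\<bar> * (2 * \<bar>f x\<bar>))" using lim by simp
      show "AE x in M. (\<lambda>i. g x * s i x) \<longlonglongrightarrow> g x * f x"
        using lim(3) by (auto intro!: AE_I2 tendsto_mult)
      show "AE x in M. norm (g x * s i x) \<le> \<bar>C\<bar> * (2 * \<bar>f x\<bar>)" for i
        using lim(4) g_le by (auto intro!: AE_I2 mult_mono simp: abs_mult)
    qed measurable
    have "T (s i) = (LINT x|M. g x * s i x)" for i by fact
    then show ?case using LIMSEQ_unique[OF lim1] lim2 by simp
  qed
  then show ?thesis using that g g_le by blast
qed

text \<open>For each b in \<open>Basis\<close>, sending a real function f to the value of L at f b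
  is a scalar functional; the densities of these functionals are the coordinates of A. The bound K
  is the sum of the coordinate bounds.\<close>

theorem L1_dual_representation:
  fixes L :: "('a \<Rightarrow> 'b::euclidean_space) \<Rightarrow> real"
  assumes fin: "finite_measure M"
    and add: "\<And>f g. integrable M f \<Longrightarrow> integrable M g \<Longrightarrow> L (\<lambda>x. f x + g x) = L f + L g"
    and scale: "\<And>c f. integrable M f \<Longrightarrow> L (\<lambda>x. c *\<^sub>R f x) = c * L f"
    and bound: "\<And>f. integrable M f \<Longrightarrow> \<bar>L f\<bar> \<le> C * (LINT x|M. norm (f x))"
  obtains A K where "A \<in> borel_measurable M" "\<And>x. norm (A x) \<le> K"
    and "\<And>f. integrable M f \<Longrightarrow> L f = (LINT x|M. A x \<bullet> f x)"
proof -
  define P where "P b g \<longleftrightarrow> g \<in> borel_measurable M \<and> (\<forall>x. \<bar>g x\<bar> \<le> \<bar>C\<bar>) \<and>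
      (\<forall>f. integrable M f \<longrightarrow> L (\<lambda>x. f x *\<^sub>R b) = (LINT x|M. g x * f x))" for b g
  have ex: "\<exists>g. P b g" if b: "b \<in> Basis" for b
  proof -
    have add': "L (\<lambda>x. (f x + g x) *\<^sub>R b) = L (\<lambda>x. f x *\<^sub>R b) + L (\<lambda>x. g x *\<^sub>R b)"
      if "integrable M f" "integrable M g" for f g :: "'a \<Rightarrow> real"
      using add[of "\<lambda>x. f x *\<^sub>R b" "\<lambda>x. g x *\<^sub>R b"] that by (simp add: scaleR_left_distrib)
    have scale': "L (\<lambda>x. (c * f x) *\<^sub>R b) = c * L (\<lambda>x. f x *\<^sub>R b)"
      if "integrable M f" for c and f :: "'a \<Rightarrow> real"
      using scale[of "\<lambda>x. f x *\<^sub>R b" c] that by simp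
    have bound': "\<bar>L (\<lambda>x. f x *\<^sub>R b)\<bar> \<le> C * (LINT x|M. \<bar>f x\<bar>)"
      if "integrable M f" for f :: "'a \<Rightarrow> real"
      using bound[of "\<lambda>x. f x *\<^sub>R b"] that b by simp
    obtain g where "g \<in> borel_measurable M" "\<And>x. \<bar>g x\<bar> \<le> \<bar>C\<bar>"
      "\<And>f. integrable M f \<Longrightarrow> L (\<lambda>x. f x *\<^sub>R b) = (LINT x|M. g x * f x)"
      using L1_dual_representation_real[OF fin add' scale' bound'] by blast
    then have "P b g" unfolding P_def by blast
    then show ?thesis by blast
  qed
  then obtain g where gP: "\<And>b. b \<in> Basis \<Longrightarrow> P b (g b)" by metis
  have g[measurable]: "\<And>b. b \<in> Basis \<Longrightarrow> g b \<in> borel_measurable M"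
    and g_le: "\<And>b x. b \<in> Basis \<Longrightarrow> \<bar>g b x\<bar> \<le> \<bar>C\<bar>"
    and g_eq: "\<And>b f. b \<in> Basis \<Longrightarrow> integrable M f \<Longrightarrow> L (\<lambda>x. f x *\<^sub>R b) = (LINT x|M. g b x * f x)"
    using gP unfolding P_def by blast+
  define A where "A x = (\<Sum>b\<in>Basis. g b x *\<^sub>R b)" for x
  have L_sum: "L (\<lambda>x. \<Sum>b\<in>B. F b x) = (\<Sum>b\<in>B. L (F b))"
    if "finite B" "\<And>b. b \<in> B \<Longrightarrow> integrable M (F b)" for B and F :: "'b \<Rightarrow> 'a \<Rightarrow> 'b"
    using that
  proof (induction B)
    case empty
    then show ?case using scale[of "\<lambda>x. 0" 0] by simp
  next
    case (insert b B)
    then show ?case using add[of "F b" "\<lambda>x. \<Sum>b\<in>B. F b x"] by simp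
  qed
  show ?thesis
  proof (rule that)
    show "A \<in> borel_measurable M" unfolding A_def by measurable
    show "norm (A x) \<le> (\<Sum>b\<in>(Basis::'b set). \<bar>C\<bar>)" for x
      unfolding A_def using g_le by (intro sum_norm_le) auto
    fix f :: "'a \<Rightarrow> 'b" assume f: "integrable M f"
    have gf: "integrable M (\<lambda>x. g b x * (f x \<bullet> b))" if "b \<in> Basis" for b
    proof (rule Bochner_Integration.integrable_bound)
      show "integrable M (\<lambda>x. \<bar>C\<bar> * (f x \<bullet> b))" using f by simp
      show "AE x in M. norm (g b x * (f x \<bullet> b)) \<le> norm (\<bar>C\<bar> * (f x \<bullet> b))"
        using g_le[OF that] by (auto simp: abs_mult intro!: mult_right_mono)
    qed (use g[OF that] f in measurable)
    have "L f = L (\<lambda>x. \<Sum>b\<in>Basis. (f x \<bullet> b) *\<^sub>R b)" by (simp add: euclidean_representation)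
    also have "\<dots> = (\<Sum>b\<in>Basis. L (\<lambda>x. (f x \<bullet> b) *\<^sub>R b))"
      using f by (intro L_sum) auto
    also have "\<dots> = (\<Sum>b\<in>Basis. (LINT x|M. g b x * (f x \<bullet> b)))"
      using f by (intro sum.cong refl g_eq) auto
    also have "\<dots> = (LINT x|M. (\<Sum>b\<in>Basis. g b x * (f x \<bullet> b)))"
      using gf by (simp add: Bochner_Integration.integral_sum)
    also have "\<dots> = (LINT x|M. A x \<bullet> f x)"
      unfolding A_def inner_sum_left by (simp add: inner_commute)
    finally show "L f = (LINT x|M. A x \<bullet> f x)" .
  qed
qed

subsection \<open>Smooth bump functions\<close>

text \<open>Iterated one-variable derivatives are exactly what appears in the partial derivatives of
  a product of functions of single coordinates.\<close>

definition smooth_real :: "(real \<Rightarrow> real) \<Rightarrow> bool" where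
  "smooth_real f \<longleftrightarrow> (\<forall>n x. ((deriv ^^ n) f) field_differentiable (at x))"

text \<open>Smoothness without a formula for the higher derivatives: it is enough to exhibit a class
  of functions that contains f and is closed under differentiation.\<close>

lemma smooth_realI:
  assumes "f \<in> \<F>" and closed: "\<And>g. g \<in> \<F> \<Longrightarrow> \<exists>g'\<in>\<F>. \<forall>x. (g has_real_derivative g' x) (at x)"
  shows "smooth_real f"
proof -
  have deriv: "deriv g \<in> \<F>" if g: "g \<in> \<F>" for g
  proof -
    obtain g' where g': "g' \<in> \<F>" "\<And>x. (g has_real_derivative g' x) (at x)"
      using closed[OF g] by blast
    then have "deriv g = g'" by (auto intro: DERIV_imp_deriv)
    then show ?thesis using g' by simp
  qed
  have "(deriv ^^ n) f \<in> \<F>" for n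
    by (induction n) (auto simp: \<open>f \<in> \<F>\<close> deriv)
  then show ?thesis
    unfolding smooth_real_def field_differentiable_def using closed by blast
qed

lemma smooth_real_has_derivative:
  assumes "smooth_real f"
  shows "((deriv ^^ n) f has_real_derivative (deriv ^^ Suc n) f x) (at x)"
  using assms by (simp add: smooth_real_def field_differentiable_derivI)

text \<open>For p = 1 this is the classical smooth function exp(-1/t), extended by zero, that is
  flat at the origin. The polynomial factor in 1/t makes the family closed under
  differentiation.\<close>

definition flat :: "real poly \<Rightarrow> real \<Rightarrow> real" where
  "flat p t = (if t > 0 then poly p (1 / t) * exp (- 1 / t) else 0)"

lemma poly_div_exp_tendsto_0: "((\<lambda>x. poly p x / exp x) \<longlongrightarrow> (0::real)) at_top"
proof -
  have "((\<lambda>x. \<Sum>i\<le>degree p. coeff p i * (x ^ i / exp x)) \<longlongrightarrow> (\<Sum>i\<le>degree p. coeff p i * 0)) at_top"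
    by (intro tendsto_intros tendsto_power_div_exp_0)
  then show ?thesis
    by (simp add: poly_altdef sum_divide_distrib)
qed

text \<open>This is the limit of the difference quotient at 0, where \<open>flat p\<close> vanishes.
  From the right, the substitution x = 1/t turns the quotient into x p(x) / exp x with x tending to
  infinity, which is why \<open>pCons 0 p\<close> appears.\<close>

lemma flat_over_id_tendsto_0: "((\<lambda>t. flat p t / t) \<longlongrightarrow> 0) (at 0)"
proof -
  have "((\<lambda>t. flat p t / t) \<longlongrightarrow> 0) (at_right 0)"
  proof (rule Lim_transform_eventually)
    show "((\<lambda>t. poly (pCons 0 p) (inverse t) / exp (inverse t)) \<longlongrightarrow> (0::real)) (at_right 0)"
      by (rule filterlim_compose[OF poly_div_exp_tendsto_0 filterlim_inverse_at_top_right])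
    show "\<forall>\<^sub>F t in at_right 0. poly (pCons 0 p) (inverse t) / exp (inverse t) = flat p t / t"
      by (auto simp: eventually_at_right_less flat_def exp_minus field_simps
          intro!: eventually_mono[OF eventually_at_right_less])
  qed
  moreover have "((\<lambda>t. flat p t / t) \<longlongrightarrow> 0) (at_left 0)"
  proof (rule Lim_transform_eventually[OF tendsto_const])
    show "\<forall>\<^sub>F t in at_left 0. 0 = flat p t / t"
      unfolding eventually_at_left_field by (rule exI[of _ "-1"]) (auto simp: flat_def)
  qed
  ultimately show ?thesis by (simp add: filterlim_at_split)
qed

text \<open>The derivative of p(1/t) exp(-1/t) is (p(1/t) - p'(1/t)) exp(-1/t) / t^2; the polynomial
  \<open>[:0, 0, 1:]\<close> is the factor 1/t^2.\<close>

definition flat_deriv :: "real poly \<Rightarrow> real poly" where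
  "flat_deriv p = [:0, 0, 1:] * (p - pderiv p)"

lemma DERIV_flat: "(flat p has_real_derivative flat (flat_deriv p) t) (at t)"
proof (cases t "0::real" rule: linorder_cases)
  case less
  have "((\<lambda>t. 0) has_real_derivative flat (flat_deriv p) t) (at t)"
    using less by (simp add: flat_def)
  then show ?thesis
  proof (rule has_field_derivative_transform_within_open)
    show "open {..<0::real}" "t \<in> {..<0}" using less by auto
  qed (auto simp: flat_def)
next
  case equal
  show ?thesis
    using flat_over_id_tendsto_0[of p] unfolding equal DERIV_def by (simp add: flat_def)
next
  case greater
  have "((\<lambda>t. poly p (1 / t) * exp (- 1 / t)) has_real_derivative flat (flat_deriv p) t) (at t)"
    using greater unfolding flat_def flat_deriv_def
    by (auto intro!: derivative_eq_intros simp: power2_eq_square field_simps)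
  then show ?thesis
  proof (rule has_field_derivative_transform_within_open)
    show "open {0::real<..}" "t \<in> {0<..}" using greater by auto
  qed (auto simp: flat_def)
qed

text \<open>The factor n + 1 steepens the flanks without moving the support: for every n the
  function is positive exactly on the open interval from a to b, and as n grows it tends pointwise
  to the indicator of this interval.\<close>

definition bump :: "nat \<Rightarrow> real \<Rightarrow> real \<Rightarrow> real \<Rightarrow> real" where
  "bump n a b t = flat 1 (real (Suc n) * (t - a)) * flat 1 (real (Suc n) * (b - t))"

text \<open>By the product and chain rules, the derivative of a product of two scaled flat functions
  is a linear combination of such products. The set is the class that \<open>smooth_realI\<close>
  asks for.\<close>

inductive_set bump_derivs :: "real \<Rightarrow> real \<Rightarrow> real \<Rightarrow> (real \<Rightarrow> real) set" for k a b where
  base: "(\<lambda>t. flat p (k * (t - a)) * flat q (k * (b - t))) \<in> bump_derivs k a b"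
| add: "f \<in> bump_derivs k a b \<Longrightarrow> g \<in> bump_derivs k a b \<Longrightarrow> (\<lambda>t. f t + g t) \<in> bump_derivs k a b"
| scale: "f \<in> bump_derivs k a b \<Longrightarrow> (\<lambda>t. c * f t) \<in> bump_derivs k a b"

lemma bump_derivs_closed:
  assumes "g \<in> bump_derivs k a b"
  shows "\<exists>g'\<in>bump_derivs k a b. \<forall>x. (g has_real_derivative g' x) (at x)"
  using assms
proof induction
  case (base p q)
  have "((\<lambda>t. flat p (k * (t - a)) * flat q (k * (b - t))) has_real_derivative
      k * (flat (flat_deriv p) (k * (x - a)) * flat q (k * (b - x))) +
      (- k) * (flat p (k * (x - a)) * flat (flat_deriv q) (k * (b - x)))) (at x)" for x
    by (rule derivative_eq_intros DERIV_chain2[OF DERIV_flat] refl | simp)+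
  then show ?case
    by (intro bexI allI)
       (assumption, intro bump_derivs.intros)
next
  case (add f g)
  then obtain f' g' where "f' \<in> bump_derivs k a b" "\<And>x. (f has_real_derivative f' x) (at x)"
    "g' \<in> bump_derivs k a b" "\<And>x. (g has_real_derivative g' x) (at x)" by blast
  then show ?case
    by (intro bexI[of _ "\<lambda>x. f' x + g' x"] allI DERIV_add bump_derivs.add)
next
  case (scale f c)
  then obtain f' where "f' \<in> bump_derivs k a b" "\<And>x. (f has_real_derivative f' x) (at x)" by blast
  then show ?case
    by (intro bexI[of _ "\<lambda>x. c * f' x"] allI DERIV_cmult bump_derivs.scale)
qed

lemma smooth_bump: "smooth_real (bump n a b)"
proof (rule smooth_realI)
  show "bump n a b \<in> bump_derivs (real (Suc n)) a b"
    unfolding bump_def[abs_def] by (rule bump_derivs.base)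
qed (rule bump_derivs_closed)

lemma bump_nonneg: "0 \<le> bump n a b t"
  by (simp add: bump_def flat_def)

lemma bump_le_1: "bump n a b t \<le> 1"
  unfolding bump_def by (rule mult_le_one) (auto simp: flat_def)

lemma bump_eq_0_iff: "bump n a b t = 0 \<longleftrightarrow> \<not> (a < t \<and> t < b)"
  by (auto simp: bump_def flat_def zero_less_mult_iff)

lemma bump_tendsto: "(\<lambda>n. bump n a b t) \<longlonglongrightarrow> (if a < t \<and> t < b then 1 else 0)"
proof (cases "a < t \<and> t < b")
  case True
  have lim: "(\<lambda>n. exp (- (1 / c) * inverse (real (Suc n)))) \<longlonglongrightarrow> 1" if "c > 0" for c :: real
  proof -
    have "(\<lambda>n. exp (- (1 / c) * inverse (real (Suc n)))) \<longlonglongrightarrow> exp (- (1 / c) * 0)"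
      by (intro tendsto_intros LIMSEQ_inverse_real_of_nat)
    then show ?thesis by simp
  qed
  have eq: "bump n a b t = exp (- (1 / (t - a)) * inverse (real (Suc n))) * exp (- (1 / (b - t)) * inverse (real (Suc n)))" for n
    using True by (simp add: bump_def flat_def zero_less_mult_iff divide_simps mult.commute)
  show ?thesis
    unfolding eq using True tendsto_mult[OF lim lim, of "t - a" "b - t"] by simp
next
  case False
  then have "bump n a b t = 0" for n by (simp add: bump_eq_0_iff)
  then show ?thesis unfolding if_not_P[OF False] by simp
qed

section \<open>Products of functions of single coordinates\<close>

lemma has_derivative_prod_coordinates:
  fixes \<beta> :: "'d::finite \<Rightarrow> real \<Rightarrow> real"
  assumes "\<And>i. (\<beta> i has_real_derivative \<beta>' i) (at (x $ i))"
  shows "((\<lambda>x. \<Prod>i\<in>UNIV. \<beta> i (x $ i)) has_derivative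
    (\<lambda>h. \<Sum>i\<in>UNIV. (\<beta>' i * (h $ i)) * (\<Prod>j\<in>UNIV - {i}. \<beta> j (x $ j)))) (at x)"
proof (rule has_derivative_prod)
  fix i
  have "((\<lambda>x. x $ i) has_derivative (\<lambda>h. h $ i)) (at x)"
    by (rule bounded_linear_imp_has_derivative[OF bounded_linear_vec_nth])
  from has_derivative_compose[OF this assms[of i, unfolded has_field_derivative_def]]
  show "((\<lambda>x. \<beta> i (x $ i)) has_derivative (\<lambda>h. \<beta>' i * (h $ i))) (at x)" .
qed

text \<open>A partial derivative in direction k acts on the k-th factor alone, so the outcome
  depends on how often each coordinate occurs in the list and not on the order.\<close>

lemma partials_prod_coordinates:
  fixes \<beta> :: "'d::finite \<Rightarrow> real \<Rightarrow> real"
  assumes smooth: "\<And>i. smooth_real (\<beta> i)"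
  shows "partials is (\<lambda>x. \<Prod>i\<in>UNIV. \<beta> i (x $ i)) =
    (\<lambda>x. \<Prod>i\<in>UNIV. (deriv ^^ count_list is i) (\<beta> i) (x $ i))"
proof (induction "is")
  case Nil
  then show ?case by simp
next
  case (Cons k "is")
  show ?case
  proof
    fix x :: "real^'d"
    let ?\<gamma> = "\<lambda>i. (deriv ^^ count_list is i) (\<beta> i)"
    have "frechet_derivative (\<lambda>x. \<Prod>i\<in>UNIV. ?\<gamma> i (x $ i)) (at x) =
      (\<lambda>h. \<Sum>i\<in>UNIV. ((deriv ^^ Suc (count_list is i)) (\<beta> i) (x $ i) * (h $ i)) * (\<Prod>j\<in>UNIV - {i}. ?\<gamma> j (x $ j)))"
      by (rule frechet_derivative_at[symmetric] has_derivative_prod_coordinates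
          smooth_real_has_derivative smooth)+
    then have "partials (k # is) (\<lambda>x. \<Prod>i\<in>UNIV. \<beta> i (x $ i)) x =
      (\<Sum>i\<in>UNIV. ((deriv ^^ Suc (count_list is i)) (\<beta> i) (x $ i) * (axis k 1 $ i)) * (\<Prod>j\<in>UNIV - {i}. ?\<gamma> j (x $ j)))"
      using Cons.IH by simp
    also have "\<dots> = (\<Sum>i\<in>UNIV. if i = k then
        (deriv ^^ Suc (count_list is k)) (\<beta> k) (x $ k) * (\<Prod>j\<in>UNIV - {k}. ?\<gamma> j (x $ j)) else 0)"
      by (intro sum.cong) (auto simp: axis_def)
    also have "\<dots> = (deriv ^^ Suc (count_list is k)) (\<beta> k) (x $ k) * (\<Prod>j\<in>UNIV - {k}. ?\<gamma> j (x $ j))"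
      by simp
    also have "\<dots> = (\<Prod>i\<in>UNIV. (deriv ^^ count_list (k # is) i) (\<beta> i) (x $ i))"
      by (subst (2) prod.remove[of _ k]) (auto intro!: prod.cong)
    finally show "partials (k # is) (\<lambda>x. \<Prod>i\<in>UNIV. \<beta> i (x $ i)) x =
      (\<Prod>i\<in>UNIV. (deriv ^^ count_list (k # is) i) (\<beta> i) (x $ i))" .
  qed
qed

definition box_bump :: "nat \<Rightarrow> real^'d::finite \<Rightarrow> real^'d \<Rightarrow> real^'d \<Rightarrow> real" where
  "box_bump n a b x = (\<Prod>i\<in>UNIV. bump n (a $ i) (b $ i) (x $ i))"

lemma partials_box_bump:
  "partials is (box_bump n a b) = (\<lambda>x. \<Prod>i\<in>UNIV. (deriv ^^ count_list is i) (bump n (a $ i) (b $ i)) (x $ i))"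
  unfolding box_bump_def[abs_def] by (rule partials_prod_coordinates[OF smooth_bump])

lemma partials_box_bump_commute: "partials [i, j] (box_bump n a b) = partials [j, i] (box_bump n a b)"
proof -
  have "count_list [i, j] = count_list [j, i]" by (auto simp: fun_eq_iff)
  then show ?thesis unfolding partials_box_bump by (simp only:)
qed

lemma box_bump_eq_0_iff: "box_bump n a b x = 0 \<longleftrightarrow> x \<notin> box a b"
  by (auto simp: box_bump_def bump_eq_0_iff mem_box_cart)

lemma box_bump_bounds: "0 \<le> box_bump n a b x" "box_bump n a b x \<le> 1"
  by (auto simp: box_bump_def bump_nonneg bump_le_1 intro!: prod_nonneg prod_le_1)

lemma box_bump_tendsto: "(\<lambda>n. box_bump n a b x) \<longlonglongrightarrow> indicator (box a b) x"
proof -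
  have "(\<lambda>n. box_bump n a b x) \<longlonglongrightarrow> (\<Prod>i\<in>UNIV. if a $ i < x $ i \<and> x $ i < b $ i then 1 else 0)"
    unfolding box_bump_def by (intro tendsto_prod bump_tendsto)
  also have "(\<Prod>i\<in>UNIV. if a $ i < x $ i \<and> x $ i < b $ i then 1 else 0) = (indicator (box a b) x :: real)"
    by (auto simp: indicator_def mem_box_cart intro!: prod.neutral)
  finally show ?thesis .
qed

lemma box_bump_test_function:
  assumes "cbox a b \<subseteq> \<Omega>"
  shows "box_bump n a b \<in> test_functions \<Omega>"
proof -
  have "closure {x. box_bump n a b x \<noteq> 0} \<subseteq> cbox a b"
    using box_subset_cbox by (intro closure_minimal) (auto simp: box_bump_eq_0_iff)
  moreover have "compact (closure {x. box_bump n a b x \<noteq> 0})"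
    by (simp add: box_bump_eq_0_iff bounded_box)
  moreover have "partials is (box_bump n a b) differentiable (at x)" for "is" x
    unfolding partials_box_bump differentiable_def
    by (rule exI has_derivative_prod_coordinates smooth_real_has_derivative smooth_bump)+
  ultimately show ?thesis
    using assms by (auto simp: test_functions_def)
qed

subsection \<open>The fundamental lemma of the calculus of variations\<close>

text \<open>The bumps lie between 0 and 1 and tend to the indicator of the open box, so |g|
  dominates and the limit passes through the integral.\<close>

lemma integral_eq_0_on_box:
  fixes g :: "real^'d::finite \<Rightarrow> real"
  assumes "open \<Omega>" and g: "integrable (lebesgue_on \<Omega>) g"
    and orth: "\<And>n a b. cbox a b \<subseteq> \<Omega> \<Longrightarrow> (LINT x|lebesgue_on \<Omega>. g x * box_bump n a b x) = 0"
    and ab: "cbox a b \<subseteq> \<Omega>"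
  shows "(LINT x|lebesgue_on \<Omega>. g x * indicator (box a b) x) = 0"
proof -
  have [measurable]: "g \<in> borel_measurable (lebesgue_on \<Omega>)" using g by simp
  have meas: "box_bump n a b \<in> borel_measurable (lebesgue_on \<Omega>)" for n
  proof -
    have "box_bump n a b differentiable (at x)" for x
      using box_bump_test_function[OF ab, of n] by (force simp: test_functions_def dest: spec[of _ "[]"])
    then have "continuous_on UNIV (box_bump n a b)"
      by (simp add: differentiable_imp_continuous_on differentiable_on_def)
    then show ?thesis
      by (metis borel_measurable_continuous_onI measurable_completion measurable_restrict_space1 measurable_lborel2)
  qed
  have "(\<lambda>n. LINT x|lebesgue_on \<Omega>. g x * box_bump n a b x) \<longlonglongrightarrow>
    (LINT x|lebesgue_on \<Omega>. g x * indicator (box a b) x)"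
  proof (rule integral_dominated_convergence)
    show "integrable (lebesgue_on \<Omega>) (\<lambda>x. \<bar>g x\<bar>)" using g by simp
    show "AE x in lebesgue_on \<Omega>. (\<lambda>n. g x * box_bump n a b x) \<longlonglongrightarrow> g x * indicator (box a b) x"
      by (intro AE_I2 tendsto_intros box_bump_tendsto)
    show "AE x in lebesgue_on \<Omega>. norm (g x * box_bump n a b x) \<le> \<bar>g x\<bar>" for n
      by (intro AE_I2)
        (simp add: abs_mult mult_left_le abs_of_nonneg[OF box_bump_bounds(1)] box_bump_bounds(2))
    show "(\<lambda>x. g x * box_bump n a b x) \<in> borel_measurable (lebesgue_on \<Omega>)" for n
      using meas by measurable
    have "(indicator (box a b) :: _ \<Rightarrow> real) \<in> borel_measurable (lebesgue_on \<Omega>)"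
      using \<open>open \<Omega>\<close> by (intro measurable_restrict_space1 borel_measurable_indicator) auto
    then show "(\<lambda>x. g x * indicator (box a b) x) \<in> borel_measurable (lebesgue_on \<Omega>)"
      by measurable
  qed
  then show ?thesis unfolding orth[OF ab] LIMSEQ_const_iff by (rule sym)
qed

text \<open>Extended by zero outside the box from c to d, g has vanishing integral over every box,
  because boxes intersect in boxes. Boxes form an intersection stable generator of the Borel sets,
  so the integrals over all Borel sets vanish. The boundary of the box is a null set, which admits
  the closed box in the conclusion.\<close>

lemma AE_eq_0_on_box:
  fixes g :: "real^'d::finite \<Rightarrow> real"
  assumes "open \<Omega>" and g: "integrable (lebesgue_on \<Omega>) g"
    and orth: "\<And>n a b. cbox a b \<subseteq> \<Omega> \<Longrightarrow> (LINT x|lebesgue_on \<Omega>. g x * box_bump n a b x) = 0"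
    and cd: "cbox c d \<subseteq> \<Omega>"
  shows "AE x in lebesgue. x \<in> cbox c d \<longrightarrow> g x = 0"
proof -
  define G where "G x = indicator (box c d) x * g x" for x
  have \<Omega>: "\<Omega> \<inter> space lebesgue \<in> sets lebesgue" using \<open>open \<Omega>\<close> by auto
  have G_restrict: "(\<lambda>x. indicator (box c d) x *\<^sub>R (indicator \<Omega> x *\<^sub>R g x)) = G"
    using cd box_subset_cbox[of c d] by (auto simp: G_def fun_eq_iff indicator_def)
  have "integrable lebesgue (\<lambda>x. indicator \<Omega> x *\<^sub>R g x)"
    using g unfolding integrable_restrict_space[OF \<Omega>] .
  then have "integrable lebesgue (\<lambda>x. indicator (box c d) x *\<^sub>R (indicator \<Omega> x *\<^sub>R g x))"
    by (rule integrable_mult_indicator[rotated]) simp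
  then have G: "integrable lebesgue G" unfolding G_restrict .
  have G_box: "(LINT x|lebesgue. indicator (box a b) x * G x) = 0" for a b
  proof -
    obtain a' b' where box: "box a b \<inter> box c d = box a' b'" and cbox: "cbox a b \<inter> cbox c d = cbox a' b'"
      using box_Int_box Int_interval by blast
    have "cbox a' b' \<subseteq> \<Omega>" using cd cbox by blast
    from integral_eq_0_on_box[OF \<open>open \<Omega>\<close> g orth this]
    have "(LINT x|lebesgue. indicator \<Omega> x *\<^sub>R (g x * indicator (box a' b') x)) = 0"
      unfolding integral_restrict_space[OF \<Omega>] by simp
    moreover have "indicator \<Omega> x *\<^sub>R (g x * indicator (box a' b') x) = indicator (box a b) x * G x" for x
      using cd box_subset_cbox[of c d] unfolding box[symmetric] by (auto simp: G_def indicator_def)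
    ultimately show ?thesis by simp
  qed
  \<comment> \<open>Boxes generate the Borel sets and not the Lebesgue sets, so G is replaced by a
    Borel function that agrees with it almost everywhere.\<close>
  have "G \<in> borel_measurable (completion lborel)" using G by simp
  then obtain h where h[measurable]: "h \<in> borel_measurable lborel" and Gh: "AE x in lborel. G x = h x"
    using completion_ex_borel_measurable_real by blast
  have Gh': "AE x in lebesgue. G x = h x" using Gh by (rule AE_completion)
  have h_leb: "h \<in> borel_measurable lebesgue" using h by (rule measurable_completion)
  have "integrable lebesgue h"
    using integrable_cong_AE[OF _ h_leb Gh'] G by simp
  then have hi: "integrable lborel h" using h by (simp add: integrable_completion)
  have h_ind: "(LINT x|lborel. indicator E x * h x) = (LINT x|lebesgue. indicator E x * G x)"
    if [measurable]: "E \<in> sets borel" for E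
  proof -
    have "(LINT x|lborel. indicator E x * h x) = (LINT x|lebesgue. indicator E x * h x)"
      by (rule integral_completion[symmetric]) measurable
    also have "\<dots> = (LINT x|lebesgue. indicator E x * G x)"
    proof (rule integral_cong_AE)
      show "AE x in lebesgue. indicator E x * h x = indicator E x * G x"
        using Gh' by eventually_elim simp
      have "(indicator E :: _ \<Rightarrow> real) \<in> borel_measurable lebesgue"
        by (intro measurable_completion) measurable
      then show "(\<lambda>x. indicator E x * h x) \<in> borel_measurable lebesgue"
        "(\<lambda>x. indicator E x * G x) \<in> borel_measurable lebesgue"
        using h_leb G by (auto intro!: borel_measurable_times)
    qed
    finally show ?thesis .
  qed
  \<comment> \<open>Complements in the induction below need the total integral; it equals the one
    over the box from c to d, outside which G vanishes.\<close>
  have G_UNIV: "(LINT x|lborel. h x) = 0"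
  proof -
    have "(LINT x|lborel. h x) = (LINT x|lborel. indicator UNIV x * h x)" by simp
    also have "\<dots> = (LINT x|lebesgue. indicator UNIV x * G x)" by (intro h_ind) simp
    also have "\<dots> = (LINT x|lebesgue. indicator (box c d) x * G x)"
      by (intro Bochner_Integration.integral_cong) (auto simp: G_def indicator_def)
    finally show ?thesis using G_box by simp
  qed
  have h0: "(LINT x|lborel. indicator E x * h x) = 0" if E: "E \<in> sets borel" for E
  proof -
    let ?B = "range (\<lambda>(a, b). box a b :: (real^'d) set)"
    have ind_int: "integrable lborel (\<lambda>x. indicator A x * h x)" if "A \<in> sets borel" for A
      using integrable_mult_indicator[of A lborel h] that hi by simp
    have sig: "sigma_sets UNIV ?B = sets borel"
      unfolding borel_eq_box by simp
    have stable: "Int_stable ?B"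
      by (auto simp: Int_stable_def box_Int_box)
    have "?B \<subseteq> Pow UNIV" "E \<in> sigma_sets UNIV ?B"
      using E unfolding sig by auto
    from stable this show ?thesis
    proof (induction rule: sigma_sets_induct_disjoint)
      case (basic A)
      then show ?case using G_box h_ind by auto
    next
      case empty
      then show ?case by simp
    next
      case (compl A)
      have "indicator (UNIV - A) x * h x = h x - indicator A x * h x" for x
        by (auto simp: indicator_def)
      then show ?case
        using compl ind_int[of A] hi G_UNIV unfolding sig by simp
    next
      case (union A)
      have A: "A i \<in> sets borel" for i using union(2) unfolding sig by blast
      have "set_integrable lborel (\<Union>i. A i) h"
        unfolding set_integrable_def using A hi by (intro integrable_mult_indicator) auto
      then have "(LINT x:(\<Union>i. A i)|lborel. h x) = (\<Sum>i. (LINT x:(A i)|lborel. h x))"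
        using A union(1) by (intro lebesgue_integral_countable_add) (auto simp: disjoint_family_on_def)
      then show ?case
        using union(3) by (simp add: set_lebesgue_integral_def)
    qed
  qed
  have "AE x in lborel. 0 \<le> h x"
    by (rule AE_nonneg_if_set_integrals_nonneg[OF hi]) (simp add: h0)
  moreover have "AE x in lborel. 0 \<le> - h x"
    by (rule AE_nonneg_if_set_integrals_nonneg) (use hi h0 in simp_all)
  ultimately have "AE x in lborel. h x = 0" by eventually_elim auto
  then have "AE x in lebesgue. h x = 0" by (rule AE_completion)
  moreover have "AE x in lebesgue. x \<notin> cbox c d - box c d"
    using negligible_frontier_interval[of c d] unfolding negligible_iff_null_sets by (rule AE_not_in)
  ultimately show ?thesis
    using Gh' by eventually_elim (auto simp: G_def indicator_def split: if_splits)
qed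

text \<open>An open set is a countable union of closed boxes, and a countable union of null sets is
  null.\<close>

theorem AE_eq_0_if_orthogonal_to_bumps:
  fixes g :: "real^'d::finite \<Rightarrow> real"
  assumes "open \<Omega>" and g: "integrable (lebesgue_on \<Omega>) g"
    and orth: "\<And>n a b. cbox a b \<subseteq> \<Omega> \<Longrightarrow> (LINT x|lebesgue_on \<Omega>. g x * box_bump n a b x) = 0"
  shows "AE x in lebesgue_on \<Omega>. g x = 0"
proof -
  obtain \<D> where \<D>: "countable \<D>" "\<D> \<subseteq> Pow \<Omega>" "\<And>X. X \<in> \<D> \<Longrightarrow> \<exists>a b. X = cbox a b" "\<Union>\<D> = \<Omega>"
    using open_countable_Union_open_cbox[OF \<open>open \<Omega>\<close>] by metis
  have "AE x in lebesgue. \<forall>X\<in>\<D>. x \<in> X \<longrightarrow> g x = 0"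
  proof (rule AE_ball_countable[THEN iffD2, OF \<D>(1)], rule ballI)
    fix X assume "X \<in> \<D>"
    then obtain a b where "X = cbox a b" "cbox a b \<subseteq> \<Omega>" using \<D> by blast
    then show "AE x in lebesgue. x \<in> X \<longrightarrow> g x = 0"
      using AE_eq_0_on_box[OF assms] by blast
  qed
  then have "AE x in lebesgue. x \<in> \<Omega> \<longrightarrow> g x = 0"
    by eventually_elim (use \<D>(4) in blast)
  then show ?thesis
    using \<open>open \<Omega>\<close> by (subst AE_restrict_space_iff) auto
qed

subsection \<open>Test functions and square integrable functions\<close>

text \<open>The derivative is a limit of difference quotients, each of which has integral zero
  because Lebesgue measure is translation invariant. The mean value theorem supplies the dominating
  function; this replaces an iterated integration along lines.\<close>

lemma integral_partial_derivative_eq_0: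
  fixes h :: "'a::euclidean_space \<Rightarrow> real"
  assumes deriv: "\<And>x. (h has_derivative h' x) (at x)"
    and cont: "continuous_on UNIV (\<lambda>x. h' x e)"
    and K: "compact K" and supp: "\<And>x. x \<notin> K \<Longrightarrow> h x = 0"
  shows "(LINT x|lborel. h' x e) = 0"
proof -
  define D where "D x = h' x e" for x
  have D0: "D x = 0" if "x \<notin> K" for x
  proof -
    have "((\<lambda>x. 0) has_derivative (\<lambda>v. 0 :: real)) (at x)" by simp
    then have "(h has_derivative (\<lambda>v. 0)) (at x)"
      by (rule has_derivative_transform_within_open[of _ _ _ _ "- K"])
        (use that supp compact_imp_closed[OF K] in auto)
    then have "h' x = (\<lambda>v. 0)" using deriv by (rule has_derivative_unique[rotated])
    then show ?thesis by (simp add: D_def)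
  qed
  obtain R where R: "\<And>x. x \<in> K \<Longrightarrow> norm x \<le> R"
    using compact_imp_bounded[OF K] by (auto simp: bounded_iff)
  have "compact (D ` K)"
    using cont K by (intro compact_continuous_image) (auto simp: D_def intro: continuous_on_subset)
  from compact_imp_bounded[OF this] obtain M where "\<And>x. x \<in> K \<Longrightarrow> \<bar>D x\<bar> \<le> M"
    unfolding bounded_iff by auto
  then have M: "\<bar>D x\<bar> \<le> \<bar>M\<bar>" for x by (cases "x \<in> K") (auto simp: D0 intro: order_trans[OF _ abs_ge_self])
  have conth: "continuous_on UNIV h"
    using deriv by (intro continuous_at_imp_continuous_on ballI has_derivative_continuous)
  have hm[measurable]: "h \<in> borel_measurable borel" "D \<in> borel_measurable borel"
    using conth cont by (auto simp: D_def[abs_def] intro: borel_measurable_continuous_onI)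
  have hi: "integrable lborel h"
  proof -
    have "integrable lborel (\<lambda>x. indicator K x *\<^sub>R h x)"
      using borel_integrable_compact[OF K] conth continuous_on_subset by blast
    moreover have "(\<lambda>x. indicator K x *\<^sub>R h x) = h" using supp by (auto simp: fun_eq_iff indicator_def)
    ultimately show ?thesis by simp
  qed
  have line: "((\<lambda>t. h (x + t *\<^sub>R e)) has_real_derivative D (x + t *\<^sub>R e)) (at t)" for x t
  proof -
    have lin: "linear (h' (x + t *\<^sub>R e))" using deriv by (rule has_derivative_linear)
    have "((\<lambda>t. x + t *\<^sub>R e) has_derivative (\<lambda>s. s *\<^sub>R e)) (at t)"
      by (auto intro!: derivative_eq_intros)
    from has_derivative_compose[OF this deriv]
    show ?thesis
      unfolding has_field_derivative_def D_def
      by (simp add: linear_scale[OF lin] mult.commute[of _ "h' (x + t *\<^sub>R e) e"])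
  qed
  \<comment> \<open>Steps of length at most 1 keep the intermediate point of the mean value theorem
    within \<open>norm e\<close> of x, so one ball carries all quotients.\<close>
  define r where "r n = inverse (real (Suc n))" for n
  have r: "0 < r n" "r n \<le> 1" for n
    by (auto simp: r_def field_simps)
  define q where "q n x = (h (x + r n *\<^sub>R e) - h x) / r n" for n x
  have q_bound: "\<bar>q n x\<bar> \<le> \<bar>M\<bar> * indicator (cball 0 (R + norm e)) x" for n x
  proof -
    obtain z where z: "0 < z" "z < r n" "h (x + r n *\<^sub>R e) - h (x + 0 *\<^sub>R e) = (r n - 0) * D (x + z *\<^sub>R e)"
      using MVT2[OF r(1)[of n], of "\<lambda>t. h (x + t *\<^sub>R e)" "\<lambda>t. D (x + t *\<^sub>R e)"] line by blast
    then have qz: "q n x = D (x + z *\<^sub>R e)" using r(1)[of n] by (simp add: q_def)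
    show ?thesis
    proof (cases "x + z *\<^sub>R e \<in> K")
      case True
      have "norm (z *\<^sub>R e) \<le> norm e" using z r(2)[of n] by (simp add: mult_left_le_one_le)
      then have "norm x \<le> R + norm e"
        using R[OF True] norm_triangle_ineq4[of "x + z *\<^sub>R e" "z *\<^sub>R e"] by simp
      then show ?thesis using M qz by simp
    next
      case False
      then show ?thesis using qz D0 by simp
    qed
  qed
  have q_int: "(LINT x|lborel. q n x) = 0" for n
  proof -
    let ?g = "\<lambda>x. r n *\<^sub>R e + x"
    have "(LINT x|lborel. h (?g x)) = (LINT x|distr lborel borel ?g. h x)"
      by (subst integral_distr) auto
    also have "\<dots> = (LINT x|lborel. h x)" by (simp add: lborel_distr_plus)
    finally have eq: "(LINT x|lborel. h (x + r n *\<^sub>R e)) = (LINT x|lborel. h x)"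
      by (simp add: add.commute)
    have "integrable (distr lborel borel ?g) h" using hi by (simp add: lborel_distr_plus)
    then have "integrable lborel (\<lambda>x. h (?g x))" by (subst (asm) integrable_distr_eq) auto
    then have "integrable lborel (\<lambda>x. h (x + r n *\<^sub>R e))" by (simp add: add.commute)
    then show ?thesis using eq hi by (simp add: q_def)
  qed
  have "(\<lambda>n. LINT x|lborel. q n x) \<longlonglongrightarrow> (LINT x|lborel. D x)"
  proof (rule integral_dominated_convergence)
    show "integrable lborel (\<lambda>x::'a. \<bar>M\<bar> * indicator (cball 0 (R + norm e)) x)"
      using emeasure_lborel_cball_finite[of "0::'a" "R + norm e"]
      by (intro integrable_mult_right integrable_real_indicator) auto
    show "AE x in lborel. norm (q n x) \<le> \<bar>M\<bar> * indicator (cball 0 (R + norm e)) x" for n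
      using q_bound by simp
    have "filterlim r (at 0) sequentially"
      unfolding filterlim_at using LIMSEQ_inverse_real_of_nat by (auto simp: r_def[abs_def])
    then have "(\<lambda>n. (h (x + (0 + r n) *\<^sub>R e) - h (x + 0 *\<^sub>R e)) / r n) \<longlonglongrightarrow> D (x + 0 *\<^sub>R e)" for x
      using line[of x 0] unfolding DERIV_def by (rule filterlim_compose[rotated])
    then show "AE x in lborel. (\<lambda>n. q n x) \<longlonglongrightarrow> D x"
      by (simp add: q_def)
    show "q n \<in> borel_measurable lborel" for n
      unfolding q_def[abs_def] by measurable
  qed measurable
  then show ?thesis unfolding q_int LIMSEQ_const_iff D_def by (rule sym)
qed

section \<open>Square integrable functions\<close>

lemma L2_D:
  assumes "v \<in> L2 \<Omega>"
  shows "v \<in> borel_measurable (lebesgue_on \<Omega>)" "integrable (lebesgue_on \<Omega>) (\<lambda>x. (v x)\<^sup>2)"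
  using assms by (auto simp: L2_def)

lemma L2_bound:
  assumes v: "v \<in> L2 \<Omega>" and w: "w \<in> borel_measurable (lebesgue_on \<Omega>)"
    and le: "AE x in lebesgue_on \<Omega>. \<bar>w x\<bar> \<le> \<bar>v x\<bar>"
  shows "w \<in> L2 \<Omega>"
proof -
  have "integrable (lebesgue_on \<Omega>) (\<lambda>x. (w x)\<^sup>2)"
  proof (rule Bochner_Integration.integrable_bound[OF L2_D(2)[OF v]])
    show "(\<lambda>x. (w x)\<^sup>2) \<in> borel_measurable (lebesgue_on \<Omega>)" using w by measurable
    show "AE x in lebesgue_on \<Omega>. norm ((w x)\<^sup>2) \<le> norm ((v x)\<^sup>2)"
      using le by eventually_elim (simp add: abs_le_square_iff)
  qed
  then show ?thesis using w by (simp add: L2_def)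
qed

lemma L2_mult_integrable:
  assumes v: "v \<in> L2 \<Omega>" and w: "w \<in> L2 \<Omega>"
  shows "integrable (lebesgue_on \<Omega>) (\<lambda>x. v x * w x)"
proof (rule Bochner_Integration.integrable_bound)
  show "integrable (lebesgue_on \<Omega>) (\<lambda>x. (v x)\<^sup>2 + (w x)\<^sup>2)"
    using L2_D[OF v] L2_D[OF w] by simp
  show "(\<lambda>x. v x * w x) \<in> borel_measurable (lebesgue_on \<Omega>)"
    using L2_D(1)[OF v] L2_D(1)[OF w] by measurable
  have "\<bar>a * b\<bar> \<le> a\<^sup>2 + b\<^sup>2" for a b :: real
    using sum_squares_bound[of "\<bar>a\<bar>" "\<bar>b\<bar>"] mult_nonneg_nonneg[OF abs_ge_zero abs_ge_zero, of a b]
    unfolding abs_mult power2_abs by linarith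
  then show "AE x in lebesgue_on \<Omega>. norm (v x * w x) \<le> norm ((v x)\<^sup>2 + (w x)\<^sup>2)"
    by simp
qed

text \<open>This estimate takes the place of the triangle inequality in L^2 and, after integration,
  in the Sobolev norms.\<close>

lemma power2_add_scale_le: "(a + c * b)\<^sup>2 \<le> 2 * a\<^sup>2 + 2 * c\<^sup>2 * b\<^sup>2" for a b c :: real
  using sum_squares_bound[of a "c * b"] by (simp add: power2_eq_square algebra_simps)

text \<open>Combinations v + c w cover sums, differences and multiples at once; the closure lemmas
  for test functions, Sobolev spaces and V keep to this form.\<close>

lemma L2_add_scale:
  assumes v: "v \<in> L2 \<Omega>" and w: "w \<in> L2 \<Omega>"
  shows "(\<lambda>x. v x + c * w x) \<in> L2 \<Omega>"
proof -
  have meas: "(\<lambda>x. v x + c * w x) \<in> borel_measurable (lebesgue_on \<Omega>)"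
    using L2_D(1)[OF v] L2_D(1)[OF w] by measurable
  have "integrable (lebesgue_on \<Omega>) (\<lambda>x. (v x + c * w x)\<^sup>2)"
  proof (rule Bochner_Integration.integrable_bound)
    show "integrable (lebesgue_on \<Omega>) (\<lambda>x. 2 * (v x)\<^sup>2 + 2 * c\<^sup>2 * (w x)\<^sup>2)"
      using L2_D[OF v] L2_D[OF w] by simp
    show "(\<lambda>x. (v x + c * w x)\<^sup>2) \<in> borel_measurable (lebesgue_on \<Omega>)" using meas by measurable
    show "AE x in lebesgue_on \<Omega>. norm ((v x + c * w x)\<^sup>2) \<le> norm (2 * (v x)\<^sup>2 + 2 * c\<^sup>2 * (w x)\<^sup>2)"
      using power2_add_scale_le by (intro AE_I2) (simp add: abs_of_nonneg)
  qed
  then show ?thesis using meas by (simp add: L2_def)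
qed

section \<open>Derivatives and linear combinations of test functions\<close>

lemma test_function_partial_has_derivative:
  assumes "\<phi> \<in> test_functions \<Omega>"
  shows "(partials is \<phi> has_derivative frechet_derivative (partials is \<phi>) (at x)) (at x)"
  using assms by (simp add: test_functions_def flip: frechet_derivative_works)

lemma test_function_partial_continuous:
  assumes "\<phi> \<in> test_functions \<Omega>"
  shows "continuous_on UNIV (partials is \<phi>)"
  using assms
  by (auto simp: test_functions_def intro!: continuous_at_imp_continuous_on differentiable_imp_continuous_within)

lemma partials_add_scale:
  assumes \<phi>: "\<phi> \<in> test_functions \<Omega>" and \<psi>: "\<psi> \<in> test_functions \<Omega>"
  shows "partials is (\<lambda>x. \<phi> x + c * \<psi> x) = (\<lambda>x. partials is \<phi> x + c * partials is \<psi> x)"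
proof (induction "is")
  case (Cons i "is")
  have "frechet_derivative (\<lambda>x. partials is \<phi> x + c * partials is \<psi> x) (at x) =
    (\<lambda>h. frechet_derivative (partials is \<phi>) (at x) h + c * frechet_derivative (partials is \<psi>) (at x) h)" for x
    by (rule frechet_derivative_at[symmetric] has_derivative_add has_derivative_mult_right
        test_function_partial_has_derivative \<phi> \<psi>)+
  then show ?case by (simp add: Cons.IH)
qed simp

lemma test_functions_add_scale:
  assumes \<phi>: "\<phi> \<in> test_functions \<Omega>" and \<psi>: "\<psi> \<in> test_functions \<Omega>"
  shows "(\<lambda>x. \<phi> x + c * \<psi> x) \<in> test_functions \<Omega>"
proof -
  let ?S = "closure {x. \<phi> x \<noteq> 0} \<union> closure {x. \<psi> x \<noteq> 0}"
  have S: "compact ?S" "?S \<subseteq> \<Omega>" using \<phi> \<psi> by (auto simp: test_functions_def)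
  have "{x. \<phi> x + c * \<psi> x \<noteq> 0} \<subseteq> {x. \<phi> x \<noteq> 0} \<union> {x. \<psi> x \<noteq> 0}" by auto
  also have "\<dots> \<subseteq> ?S" by (intro Un_mono closure_subset)
  finally have sub: "closure {x. \<phi> x + c * \<psi> x \<noteq> 0} \<subseteq> ?S" by (intro closure_minimal) auto
  then have "compact (closure {x. \<phi> x + c * \<psi> x \<noteq> 0})"
    using bounded_subset[OF compact_imp_bounded[OF S(1)] sub] closed_closure
    unfolding compact_eq_bounded_closed by blast
  moreover have "partials is (\<lambda>x. \<phi> x + c * \<psi> x) differentiable (at x)" for "is" x
    using \<phi> \<psi> unfolding partials_add_scale[OF \<phi> \<psi>] by (simp add: test_functions_def)
  ultimately show ?thesis using sub S(2) by (auto simp: test_functions_def)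
qed

subsection \<open>Weak derivatives and Sobolev spaces\<close>

locale bounded_open =
  fixes \<Omega> :: "(real^'d::finite) set"
  assumes open_dom: "open \<Omega>" and bounded_dom: "bounded \<Omega>"
begin

lemma dom_sets: "\<Omega> \<inter> space lebesgue \<in> sets lebesgue"
  using open_dom by auto

lemma finite_measure_dom: "finite_measure (lebesgue_on \<Omega>)"
proof (rule finite_measureI)
  have "\<Omega> \<in> lmeasurable"
    using open_dom bounded_dom by (intro bounded_set_imp_lmeasurable) auto
  then have "emeasure lebesgue \<Omega> < \<infinity>" by (simp add: fmeasurable_def del: emeasure_completion)
  then show "emeasure (lebesgue_on \<Omega>) (space (lebesgue_on \<Omega>)) \<noteq> \<infinity>"
    using open_dom by (simp add: emeasure_restrict_space del: emeasure_completion)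
qed

lemma bounded_L2:
  assumes "f \<in> borel_measurable (lebesgue_on \<Omega>)" "\<And>x. x \<in> \<Omega> \<Longrightarrow> \<bar>f x\<bar> \<le> K"
  shows "f \<in> L2 \<Omega>"
proof (rule L2_bound)
  interpret finite_measure "lebesgue_on \<Omega>" by (rule finite_measure_dom)
  show "(\<lambda>x. K) \<in> L2 \<Omega>" by (simp add: L2_def)
  show "AE x in lebesgue_on \<Omega>. \<bar>f x\<bar> \<le> \<bar>K\<bar>"
    using assms(2) by (intro AE_I2) fastforce
qed (rule assms)

lemma L2_integrable: "v \<in> L2 \<Omega> \<Longrightarrow> integrable (lebesgue_on \<Omega>) v"
  using L2_mult_integrable[of v \<Omega> "\<lambda>x. 1"] bounded_L2[of "\<lambda>x. 1" 1] by simp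

lemma test_function_partial_L2:
  assumes "\<phi> \<in> test_functions \<Omega>"
  shows "partials is \<phi> \<in> L2 \<Omega>"
proof -
  have cont: "continuous_on UNIV (partials is \<phi>)"
    using assms by (rule test_function_partial_continuous)
  have "compact (partials is \<phi> ` closure \<Omega>)"
    using bounded_dom cont continuous_on_subset by (intro compact_continuous_image) auto
  from compact_imp_bounded[OF this] obtain K where K: "\<And>x. x \<in> closure \<Omega> \<Longrightarrow> \<bar>partials is \<phi> x\<bar> \<le> K"
    unfolding bounded_iff by auto
  show ?thesis
  proof (rule bounded_L2)
    have "partials is \<phi> \<in> borel_measurable lborel"
      using borel_measurable_continuous_onI[OF cont] by simp
    then show "partials is \<phi> \<in> borel_measurable (lebesgue_on \<Omega>)"
      by (intro measurable_restrict_space1 measurable_completion)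
    show "\<bar>partials is \<phi> x\<bar> \<le> K" if "x \<in> \<Omega>" for x
      using K closure_subset that by blast
  qed
qed

lemma test_function_L2: "\<phi> \<in> test_functions \<Omega> \<Longrightarrow> \<phi> \<in> L2 \<Omega>"
  using test_function_partial_L2[of \<phi> "[]"] by simp

text \<open>The difference of two candidates is orthogonal to all bumps. This makes the arbitrary
  choice in \<open>weak_deriv\<close> harmless: a formula for a weak derivative holds almost
  everywhere as soon as its right-hand side is itself a weak derivative in L^2.\<close>

lemma has_weak_deriv_unique:
  assumes g: "g \<in> L2 \<Omega>" "has_weak_deriv \<Omega> is v g" and h: "h \<in> L2 \<Omega>" "has_weak_deriv \<Omega> is v h"
  shows "AE x in lebesgue_on \<Omega>. g x = h x"
proof -
  have "AE x in lebesgue_on \<Omega>. g x - h x = 0"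
  proof (rule AE_eq_0_if_orthogonal_to_bumps[OF open_dom])
    show "integrable (lebesgue_on \<Omega>) (\<lambda>x. g x - h x)"
      using g h by (simp add: L2_integrable)
    fix n a b assume "cbox a b \<subseteq> \<Omega>"
    then have \<phi>: "box_bump n a b \<in> test_functions \<Omega>" by (rule box_bump_test_function)
    then have "(LINT x|lebesgue_on \<Omega>. g x * box_bump n a b x) = (LINT x|lebesgue_on \<Omega>. h x * box_bump n a b x)"
      using g(2) h(2) unfolding has_weak_deriv_def by simp
    moreover have "integrable (lebesgue_on \<Omega>) (\<lambda>x. g x * box_bump n a b x)"
      "integrable (lebesgue_on \<Omega>) (\<lambda>x. h x * box_bump n a b x)"
      using g h \<phi> by (auto intro: L2_mult_integrable test_function_L2)
    ultimately show "(LINT x|lebesgue_on \<Omega>. (g x - h x) * box_bump n a b x) = 0"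
      by (simp add: left_diff_distrib)
  qed
  then show ?thesis by eventually_elim simp
qed

lemma has_weak_deriv_add_scale:
  assumes L2: "v \<in> L2 \<Omega>" "w \<in> L2 \<Omega>" "g \<in> L2 \<Omega>" "h \<in> L2 \<Omega>"
    and g: "has_weak_deriv \<Omega> is v g" and h: "has_weak_deriv \<Omega> is w h"
  shows "has_weak_deriv \<Omega> is (\<lambda>x. v x + c * w x) (\<lambda>x. g x + c * h x)"
  unfolding has_weak_deriv_def
proof
  fix \<phi> assume \<phi>: "\<phi> \<in> test_functions \<Omega>"
  have int: "integrable (lebesgue_on \<Omega>) (\<lambda>x. v x * partials is \<phi> x)"
    "integrable (lebesgue_on \<Omega>) (\<lambda>x. w x * partials is \<phi> x)"
    "integrable (lebesgue_on \<Omega>) (\<lambda>x. g x * \<phi> x)"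
    "integrable (lebesgue_on \<Omega>) (\<lambda>x. h x * \<phi> x)"
    using L2 \<phi> by (auto intro: L2_mult_integrable test_function_partial_L2 test_function_L2)
  have "(LINT x|lebesgue_on \<Omega>. (v x + c * w x) * partials is \<phi> x) =
    (LINT x|lebesgue_on \<Omega>. v x * partials is \<phi> x) + c * (LINT x|lebesgue_on \<Omega>. w x * partials is \<phi> x)"
    using int(1,2) by (simp add: distrib_right mult.assoc)
  also have "\<dots> = (-1) ^ length is * ((LINT x|lebesgue_on \<Omega>. g x * \<phi> x) + c * (LINT x|lebesgue_on \<Omega>. h x * \<phi> x))"
    using g h \<phi> by (simp add: has_weak_deriv_def algebra_simps)
  also have "(LINT x|lebesgue_on \<Omega>. g x * \<phi> x) + c * (LINT x|lebesgue_on \<Omega>. h x * \<phi> x) =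
    (LINT x|lebesgue_on \<Omega>. (g x + c * h x) * \<phi> x)"
    using int(3,4) by (simp add: distrib_right mult.assoc)
  finally show "(LINT x|lebesgue_on \<Omega>. (v x + c * w x) * partials is \<phi> x) =
    (-1) ^ length is * (LINT x|lebesgue_on \<Omega>. (g x + c * h x) * \<phi> x)" .
qed

lemma sobolev_L2: "v \<in> sobolev k \<Omega> \<Longrightarrow> v \<in> L2 \<Omega>"
  by (simp add: sobolev_def)

lemma weak_deriv_sobolev:
  assumes "v \<in> sobolev k \<Omega>" "length is \<le> k"
  shows "weak_deriv \<Omega> is v \<in> L2 \<Omega>" "has_weak_deriv \<Omega> is v (weak_deriv \<Omega> is v)"
proof -
  have "\<exists>g. g \<in> L2 \<Omega> \<and> has_weak_deriv \<Omega> is v g"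
    using assms by (auto simp: sobolev_def)
  from someI_ex[OF this]
  show "weak_deriv \<Omega> is v \<in> L2 \<Omega>" "has_weak_deriv \<Omega> is v (weak_deriv \<Omega> is v)"
    unfolding weak_deriv_def by auto
qed

lemma sobolev_add_scale:
  assumes v: "v \<in> sobolev k \<Omega>" and w: "w \<in> sobolev k \<Omega>"
  shows "(\<lambda>x. v x + c * w x) \<in> sobolev k \<Omega>"
  unfolding sobolev_def
proof (intro CollectI conjI allI impI)
  show "(\<lambda>x. v x + c * w x) \<in> L2 \<Omega>"
    using v w by (intro L2_add_scale sobolev_L2)
  fix "is" :: "'d list" assume len: "length is \<le> k"
  note v' = weak_deriv_sobolev[OF v len] and w' = weak_deriv_sobolev[OF w len]
  show "\<exists>g\<in>L2 \<Omega>. has_weak_deriv \<Omega> is (\<lambda>x. v x + c * w x) g"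
    using has_weak_deriv_add_scale[OF sobolev_L2[OF v] sobolev_L2[OF w] v'(1) w'(1) v'(2) w'(2)]
      L2_add_scale[OF v'(1) w'(1)] by blast
qed

lemma weak_deriv_add_scale:
  assumes v: "v \<in> sobolev k \<Omega>" and w: "w \<in> sobolev k \<Omega>" and len: "length is \<le> k"
  shows "AE x in lebesgue_on \<Omega>.
    weak_deriv \<Omega> is (\<lambda>x. v x + c * w x) x = weak_deriv \<Omega> is v x + c * weak_deriv \<Omega> is w x"
proof (rule has_weak_deriv_unique)
  note vw = sobolev_add_scale[OF v w]
  show "weak_deriv \<Omega> is (\<lambda>x. v x + c * w x) \<in> L2 \<Omega>"
    "has_weak_deriv \<Omega> is (\<lambda>x. v x + c * w x) (weak_deriv \<Omega> is (\<lambda>x. v x + c * w x))"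
    using weak_deriv_sobolev[OF vw len] by auto
  show "(\<lambda>x. weak_deriv \<Omega> is v x + c * weak_deriv \<Omega> is w x) \<in> L2 \<Omega>"
    "has_weak_deriv \<Omega> is (\<lambda>x. v x + c * w x) (\<lambda>x. weak_deriv \<Omega> is v x + c * weak_deriv \<Omega> is w x)"
    using v w len by (auto intro!: L2_add_scale has_weak_deriv_add_scale intro: weak_deriv_sobolev sobolev_L2)
qed

text \<open>The derivative of \<phi> \<psi> in direction i has integral zero over the whole space,
  and it vanishes outside the support of \<phi>, so this integral is the one over \<Omega>.\<close>

lemma integral_by_parts_test_functions:
  assumes \<phi>: "\<phi> \<in> test_functions \<Omega>" and \<psi>: "\<psi> \<in> test_functions \<Omega>"
  shows "(LINT x|lebesgue_on \<Omega>. \<phi> x * partials [i] \<psi> x) = - (LINT x|lebesgue_on \<Omega>. partials [i] \<phi> x * \<psi> x)"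
proof -
  let ?K = "closure {x. \<phi> x \<noteq> 0}"
  define h' where "h' x v = \<phi> x * frechet_derivative \<psi> (at x) v + frechet_derivative \<phi> (at x) v * \<psi> x" for x v
  have K: "compact ?K" "?K \<subseteq> \<Omega>" using \<phi> by (auto simp: test_functions_def)
  have supp: "\<phi> x = 0" if "x \<notin> ?K" for x
    using that closure_subset[of "{x. \<phi> x \<noteq> 0}"] by auto
  have h'_axis: "h' x (axis i 1) = \<phi> x * partials [i] \<psi> x + partials [i] \<phi> x * \<psi> x" for x
    by (simp add: h'_def)
  have cont: "continuous_on UNIV (\<lambda>x. \<phi> x * partials [i] \<psi> x + partials [i] \<phi> x * \<psi> x)"
    using test_function_partial_continuous[OF \<phi>, of "[]"] test_function_partial_continuous[OF \<psi>, of "[]"]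
      test_function_partial_continuous[OF \<phi>, of "[i]"] test_function_partial_continuous[OF \<psi>, of "[i]"]
    by (intro continuous_intros) simp_all
  have deriv: "((\<lambda>x. \<phi> x * \<psi> x) has_derivative h' x) (at x)" for x
    unfolding h'_def
    using has_derivative_mult[OF test_function_partial_has_derivative[OF \<phi>, of "[]" x]
        test_function_partial_has_derivative[OF \<psi>, of "[]" x]] by simp
  have zero: "(LINT x|lborel. h' x (axis i 1)) = 0"
  proof (rule integral_partial_derivative_eq_0[OF deriv _ K(1)])
    show "continuous_on UNIV (\<lambda>x. h' x (axis i 1))" unfolding h'_axis by (rule cont)
    show "\<phi> x * \<psi> x = 0" if "x \<notin> ?K" for x using supp[OF that] by simp
  qed
  have out: "h' x (axis i 1) = 0" if "x \<notin> ?K" for x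
  proof -
    have "((\<lambda>x. 0) has_derivative (\<lambda>v. 0 :: real)) (at x)" by simp
    then have "(\<phi> has_derivative (\<lambda>v. 0)) (at x)"
    proof (rule has_derivative_transform_within_open)
      show "open (- ?K)" by (intro open_Compl closed_closure)
      show "x \<in> - ?K" using that by simp
      show "0 = \<phi> y" if "y \<in> - ?K" for y using that by (intro sym[OF supp]) (rule ComplD)
    qed
    then have "frechet_derivative \<phi> (at x) = (\<lambda>v. 0)"
      by (rule frechet_derivative_at[symmetric])
    then show ?thesis using supp[OF that] by (simp add: h'_def)
  qed
  have "(LINT x|lebesgue_on \<Omega>. h' x (axis i 1)) = (LINT x|lebesgue. indicator \<Omega> x *\<^sub>R h' x (axis i 1))"
    by (rule integral_restrict_space[OF dom_sets])
  also have "\<dots> = (LINT x|lebesgue. h' x (axis i 1))"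
    using out K(2) by (intro Bochner_Integration.integral_cong) (auto simp: indicator_def)
  also have "\<dots> = (LINT x|lborel. h' x (axis i 1))"
    using borel_measurable_continuous_onI[OF cont] by (intro integral_completion) (simp add: h'_axis)
  also note zero
  finally have "(LINT x|lebesgue_on \<Omega>. \<phi> x * partials [i] \<psi> x + partials [i] \<phi> x * \<psi> x) = 0"
    unfolding h'_axis .
  moreover have "integrable (lebesgue_on \<Omega>) (\<lambda>x. \<phi> x * partials [i] \<psi> x)"
    by (rule L2_mult_integrable[OF test_function_L2[OF \<phi>] test_function_partial_L2[OF \<psi>]])
  moreover have "integrable (lebesgue_on \<Omega>) (\<lambda>x. partials [i] \<phi> x * \<psi> x)"
    by (rule L2_mult_integrable[OF test_function_partial_L2[OF \<phi>] test_function_L2[OF \<psi>]])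
  ultimately show ?thesis by simp
qed

text \<open>Needed for the differences v - \<phi> in \<open>H10\<close>: once these are known to be
  Sobolev functions, the choices made by \<open>weak_deriv\<close> in \<open>sobolev_norm 1\<close>
  are weak derivatives and can be estimated.\<close>

lemma test_function_sobolev_1:
  assumes \<phi>: "\<phi> \<in> test_functions \<Omega>"
  shows "\<phi> \<in> sobolev 1 \<Omega>"
  unfolding sobolev_def
proof (intro CollectI conjI allI impI)
  show "\<phi> \<in> L2 \<Omega>" using \<phi> by (rule test_function_L2)
  fix "is" :: "'d list" assume "length is \<le> 1"
  then consider "is = []" | i where "is = [i]"
    by (cases "is") auto
  then show "\<exists>g\<in>L2 \<Omega>. has_weak_deriv \<Omega> is \<phi> g"
  proof cases
    case 1
    then have "has_weak_deriv \<Omega> is \<phi> \<phi>" by (simp add: has_weak_deriv_def)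
    then show ?thesis using test_function_L2[OF \<phi>] by blast
  next
    case 2
    then have "has_weak_deriv \<Omega> is \<phi> (partials [i] \<phi>)"
      using integral_by_parts_test_functions[OF \<phi>] unfolding has_weak_deriv_def by simp
    then show ?thesis using test_function_partial_L2[OF \<phi>] by blast
  qed
qed

section \<open>Sobolev norms and the linear structure of V\<close>

lemma sobolev_norm_nonneg: "0 \<le> sobolev_norm k \<Omega> v"
  unfolding sobolev_norm_def L2_inner_def by (auto intro!: sum_nonneg)

lemma sobolev_norm_power2:
  "(sobolev_norm k \<Omega> v)\<^sup>2 = (\<Sum>is | length is \<le> k. LINT x|lebesgue_on \<Omega>. (weak_deriv \<Omega> is v x)\<^sup>2)"
  unfolding sobolev_norm_def L2_inner_def
  by (subst real_sqrt_pow2) (auto intro!: sum_nonneg simp: power2_eq_square)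

lemma sobolev_norm_add_scale:
  assumes v: "v \<in> sobolev k \<Omega>" and w: "w \<in> sobolev k \<Omega>"
  shows "(sobolev_norm k \<Omega> (\<lambda>x. v x + c * w x))\<^sup>2 \<le>
    2 * (sobolev_norm k \<Omega> v)\<^sup>2 + 2 * c\<^sup>2 * (sobolev_norm k \<Omega> w)\<^sup>2"
  unfolding sobolev_norm_power2 sum_distrib_left sum.distrib[symmetric]
proof (rule sum_mono)
  fix "is" :: "'d list" assume "is \<in> {is. length is \<le> k}"
  then have len: "length is \<le> k" by simp
  let ?v = "weak_deriv \<Omega> is v" and ?w = "weak_deriv \<Omega> is w"
  have int: "integrable (lebesgue_on \<Omega>) (\<lambda>x. (?v x)\<^sup>2)" "integrable (lebesgue_on \<Omega>) (\<lambda>x. (?w x)\<^sup>2)"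
    using weak_deriv_sobolev(1)[OF v len] weak_deriv_sobolev(1)[OF w len] by (auto simp: L2_D)
  have "(LINT x|lebesgue_on \<Omega>. (weak_deriv \<Omega> is (\<lambda>x. v x + c * w x) x)\<^sup>2) \<le>
    (LINT x|lebesgue_on \<Omega>. 2 * (?v x)\<^sup>2 + 2 * c\<^sup>2 * (?w x)\<^sup>2)"
  proof (rule integral_mono_AE)
    show "integrable (lebesgue_on \<Omega>) (\<lambda>x. (weak_deriv \<Omega> is (\<lambda>x. v x + c * w x) x)\<^sup>2)"
      using weak_deriv_sobolev(1)[OF sobolev_add_scale[OF v w] len] by (rule L2_D)
    show "integrable (lebesgue_on \<Omega>) (\<lambda>x. 2 * (?v x)\<^sup>2 + 2 * c\<^sup>2 * (?w x)\<^sup>2)"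
      using int by simp
    show "AE x in lebesgue_on \<Omega>. (weak_deriv \<Omega> is (\<lambda>x. v x + c * w x) x)\<^sup>2 \<le> 2 * (?v x)\<^sup>2 + 2 * c\<^sup>2 * (?w x)\<^sup>2"
      using weak_deriv_add_scale[OF v w len, of c] by eventually_elim (simp add: power2_add_scale_le)
  qed
  also have "\<dots> = 2 * (LINT x|lebesgue_on \<Omega>. (?v x)\<^sup>2) + 2 * c\<^sup>2 * (LINT x|lebesgue_on \<Omega>. (?w x)\<^sup>2)"
    using int by simp
  finally show "(LINT x|lebesgue_on \<Omega>. (weak_deriv \<Omega> is (\<lambda>x. v x + c * w x) x)\<^sup>2) \<le>
    2 * (LINT x|lebesgue_on \<Omega>. (?v x)\<^sup>2) + 2 * c\<^sup>2 * (LINT x|lebesgue_on \<Omega>. (?w x)\<^sup>2)" .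
qed

lemma H10_add_scale:
  assumes v: "v \<in> H10 \<Omega>" and w: "w \<in> H10 \<Omega>"
  shows "(\<lambda>x. v x + c * w x) \<in> H10 \<Omega>"
  unfolding H10_def
proof (intro CollectI conjI allI impI)
  have sob: "v \<in> sobolev 1 \<Omega>" "w \<in> sobolev 1 \<Omega>" using v w by (auto simp: H10_def)
  then show "(\<lambda>x. v x + c * w x) \<in> sobolev 1 \<Omega>" by (rule sobolev_add_scale)
  fix \<epsilon> :: real assume \<epsilon>: "\<epsilon> > 0"
  \<comment> \<open>The denominator 1 + |c| also covers c = 0. Both contributions are then at most
    \<epsilon>/2, the first one strictly, and 2 (\<epsilon>/2)^2 + 2 (\<epsilon>/2)^2 =
    \<epsilon>^2.\<close>
  define \<delta> where "\<delta> = \<epsilon> / 2 / (1 + \<bar>c\<bar>)"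
  have c: "1 + \<bar>c\<bar> > 0" by linarith
  then have \<delta>: "\<delta> > 0" using \<epsilon> by (simp add: \<delta>_def)
  obtain \<phi> where \<phi>: "\<phi> \<in> test_functions \<Omega>" "sobolev_norm 1 \<Omega> (\<lambda>x. v x - \<phi> x) < \<epsilon> / 2"
    using v \<epsilon> unfolding H10_def by (auto dest: spec[of _ "\<epsilon> / 2"])
  obtain \<psi> where \<psi>: "\<psi> \<in> test_functions \<Omega>" "sobolev_norm 1 \<Omega> (\<lambda>x. w x - \<psi> x) < \<delta>"
    using w \<delta> unfolding H10_def by blast
  let ?v = "\<lambda>x. v x - \<phi> x" and ?w = "\<lambda>x. w x - \<psi> x"
  have diff: "?v \<in> sobolev 1 \<Omega>" "?w \<in> sobolev 1 \<Omega>"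
    using sobolev_add_scale[OF sob(1) test_function_sobolev_1[OF \<phi>(1)], of "-1"]
      sobolev_add_scale[OF sob(2) test_function_sobolev_1[OF \<psi>(1)], of "-1"] by simp_all
  have "\<bar>c\<bar> * sobolev_norm 1 \<Omega> ?w \<le> (1 + \<bar>c\<bar>) * \<delta>"
    using \<psi>(2) sobolev_norm_nonneg by (intro mult_mono) auto
  also have "\<dots> = \<epsilon> / 2"
    unfolding \<delta>_def using c by (metis less_numeral_extra(3) nonzero_mult_div_cancel_left times_divide_eq_right)
  finally have "(\<bar>c\<bar> * sobolev_norm 1 \<Omega> ?w)\<^sup>2 \<le> (\<epsilon> / 2)\<^sup>2"
    using sobolev_norm_nonneg by (intro power_mono) auto
  moreover have "(sobolev_norm 1 \<Omega> ?v)\<^sup>2 < (\<epsilon> / 2)\<^sup>2"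
    using \<phi>(2) sobolev_norm_nonneg by (intro power_strict_mono) auto
  moreover have "(sobolev_norm 1 \<Omega> (\<lambda>x. ?v x + c * ?w x))\<^sup>2 \<le>
      2 * (sobolev_norm 1 \<Omega> ?v)\<^sup>2 + 2 * c\<^sup>2 * (sobolev_norm 1 \<Omega> ?w)\<^sup>2"
    by (rule sobolev_norm_add_scale[OF diff])
  ultimately have "(sobolev_norm 1 \<Omega> (\<lambda>x. ?v x + c * ?w x))\<^sup>2 < \<epsilon>\<^sup>2"
    by (simp add: power_mult_distrib power_divide)
  then have "sobolev_norm 1 \<Omega> (\<lambda>x. ?v x + c * ?w x) < \<epsilon>"
    by (rule power2_less_imp_less) (use \<epsilon> in simp)
  moreover have "(\<lambda>x. ?v x + c * ?w x) = (\<lambda>x. (v x + c * w x) - (\<phi> x + c * \<psi> x))"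
    by (simp add: fun_eq_iff algebra_simps)
  ultimately show "\<exists>\<phi>\<in>test_functions \<Omega>. sobolev_norm 1 \<Omega> (\<lambda>x. v x + c * w x - \<phi> x) < \<epsilon>"
    using bexI[OF _ test_functions_add_scale[OF \<phi>(1) \<psi>(1), of c]] by simp
qed

lemma V_space_add_scale:
  assumes "v \<in> V_space \<Omega>" "w \<in> V_space \<Omega>"
  shows "(\<lambda>x. v x + c * w x) \<in> V_space \<Omega>"
proof -
  have "v \<in> sobolev 2 \<Omega>" "w \<in> sobolev 2 \<Omega>" "v \<in> H10 \<Omega>" "w \<in> H10 \<Omega>"
    using assms by (auto simp: V_space_def)
  then show ?thesis
    unfolding V_space_def by (intro IntI sobolev_add_scale[of v 2 w] H10_add_scale[of v w])
qed

section \<open>The weak Hessian\<close>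

lemma weak_hessian_add_scale:
  assumes v: "v \<in> V_space \<Omega>" and w: "w \<in> V_space \<Omega>"
  shows "AE x in lebesgue_on \<Omega>. weak_hessian \<Omega> (\<lambda>x. v x + c * w x) x =
    weak_hessian \<Omega> v x + c *\<^sub>R weak_hessian \<Omega> w x"
proof -
  have "AE x in lebesgue_on \<Omega>. \<forall>i j. weak_deriv \<Omega> [i, j] (\<lambda>x. v x + c * w x) x =
    weak_deriv \<Omega> [i, j] v x + c * weak_deriv \<Omega> [i, j] w x"
    using v w by (auto simp: V_space_def AE_all_countable intro: weak_deriv_add_scale[where k = 2])
  then show ?thesis
    by eventually_elim (simp add: weak_hessian_def vec_eq_iff)
qed

text \<open>
  Only products of functions of one variable are used as test functions here, so that the symmetry
  of their second derivatives is a matter of counting the derivatives in each variable.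
\<close>

lemma weak_hessian_symmetric:
  assumes v: "v \<in> V_space \<Omega>"
  shows "AE x in lebesgue_on \<Omega>. weak_hessian \<Omega> v x \<in> sym_matrices"
proof -
  have sob: "v \<in> sobolev 2 \<Omega>" using v by (simp add: V_space_def)
  have "AE x in lebesgue_on \<Omega>. weak_deriv \<Omega> [i, j] v x - weak_deriv \<Omega> [j, i] v x = 0" for i j
  proof (rule AE_eq_0_if_orthogonal_to_bumps[OF open_dom])
    have L2: "weak_deriv \<Omega> [i, j] v \<in> L2 \<Omega>" "weak_deriv \<Omega> [j, i] v \<in> L2 \<Omega>"
      using weak_deriv_sobolev(1)[OF sob] by auto
    then show "integrable (lebesgue_on \<Omega>) (\<lambda>x. weak_deriv \<Omega> [i, j] v x - weak_deriv \<Omega> [j, i] v x)"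
      by (intro Bochner_Integration.integrable_diff L2_integrable)
    fix n a b assume "cbox a b \<subseteq> \<Omega>"
    then have \<phi>: "box_bump n a b \<in> test_functions \<Omega>" by (rule box_bump_test_function)
    have "(LINT x|lebesgue_on \<Omega>. weak_deriv \<Omega> [k, l] v x * box_bump n a b x) =
        (LINT x|lebesgue_on \<Omega>. v x * partials [k, l] (box_bump n a b) x)" for k l
      using weak_deriv_sobolev(2)[OF sob, of "[k, l]"] \<phi> by (simp add: has_weak_deriv_def del: partials.simps)
    then have "(LINT x|lebesgue_on \<Omega>. weak_deriv \<Omega> [i, j] v x * box_bump n a b x) =
        (LINT x|lebesgue_on \<Omega>. weak_deriv \<Omega> [j, i] v x * box_bump n a b x)"
      by (simp only: partials_box_bump_commute[of i j])
    moreover have "integrable (lebesgue_on \<Omega>) (\<lambda>x. weak_deriv \<Omega> [i, j] v x * box_bump n a b x)"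
      "integrable (lebesgue_on \<Omega>) (\<lambda>x. weak_deriv \<Omega> [j, i] v x * box_bump n a b x)"
      using L2 \<phi> by (auto intro: L2_mult_integrable test_function_L2)
    ultimately show "(LINT x|lebesgue_on \<Omega>. (weak_deriv \<Omega> [i, j] v x - weak_deriv \<Omega> [j, i] v x) *
        box_bump n a b x) = 0"
      by (simp add: left_diff_distrib)
  qed
  then have "AE x in lebesgue_on \<Omega>. \<forall>i j. weak_deriv \<Omega> [i, j] v x - weak_deriv \<Omega> [j, i] v x = 0"
    by (simp add: AE_all_countable)
  then show ?thesis
    by eventually_elim (simp add: weak_hessian_def sym_matrices_def transpose_def vec_eq_iff)
qed

lemma weak_hessian_measurable:
  assumes v: "v \<in> V_space \<Omega>"
  shows "weak_hessian \<Omega> v \<in> borel_measurable (lebesgue_on \<Omega>)"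
proof -
  have [measurable]: "weak_deriv \<Omega> [i, j] v \<in> borel_measurable (lebesgue_on \<Omega>)" for i j
    using weak_deriv_sobolev(1)[of v 2 "[i, j]"] v by (auto simp: V_space_def intro: L2_D)
  show ?thesis
    by (subst borel_measurable_euclidean_space)
      (auto simp: Basis_vec_def inner_axis weak_hessian_def)
qed

lemma norm_weak_hessian_L2:
  assumes v: "v \<in> V_space \<Omega>"
  shows "(\<lambda>x. norm (weak_hessian \<Omega> v x)) \<in> L2 \<Omega>"
proof -
  have "integrable (lebesgue_on \<Omega>) (\<lambda>x. (weak_deriv \<Omega> [i, j] v x)\<^sup>2)" for i j
    using weak_deriv_sobolev(1)[of v 2 "[i, j]"] v by (auto simp: V_space_def intro: L2_D)
  then have "integrable (lebesgue_on \<Omega>) (\<lambda>x. \<Sum>i\<in>UNIV. \<Sum>j\<in>UNIV. (weak_deriv \<Omega> [i, j] v x)\<^sup>2)"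
    by simp
  moreover have "(norm (weak_hessian \<Omega> v x))\<^sup>2 = (\<Sum>i\<in>UNIV. \<Sum>j\<in>UNIV. (weak_deriv \<Omega> [i, j] v x)\<^sup>2)" for x
    unfolding power2_norm_eq_inner inner_vec_def weak_hessian_def by (simp add: power2_eq_square)
  ultimately show ?thesis
    using weak_hessian_measurable[OF v] by (simp add: L2_def)
qed

end

subsection \<open>The Hamiltonian\<close>

lemma inner_transpose: "transpose A \<bullet> transpose B = A \<bullet> (B :: real^'d^'d::finite)"
  unfolding inner_vec_def transpose_def by (simp, rule sum.swap)

text \<open>Transposing both factors preserves the inner product, yet changes its sign here.\<close>

lemma inner_symmetric_antisymmetric:
  fixes A N :: "real^'d^'d::finite"
  assumes "A \<in> sym_matrices" "transpose N = - N"
  shows "A \<bullet> N = 0"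
  using inner_transpose[of A N] assms by (simp add: sym_matrices_def)

lemma transpose_diff: "transpose (A - B) = transpose A - transpose (B :: real^'d^'d::finite)"
  by (simp add: transpose_def vec_eq_iff)

locale hamiltonian_data = bounded_open \<Omega>
  for \<Omega> :: "(real^'d::finite) set" +
  fixes \<A> :: "'a::metric_space set"
    and a :: "real^'d \<Rightarrow> 'a \<Rightarrow> real^'d^'d"
    and f :: "real^'d \<Rightarrow> 'a \<Rightarrow> real"
  assumes compact_controls: "compact \<A>" and controls_nonempty: "\<A> \<noteq> {}"
    and cont_a: "continuous_on (closure \<Omega> \<times> \<A>) (\<lambda>(x, \<alpha>). a x \<alpha>)"
    and sym_a: "\<And>x \<alpha>. x \<in> closure \<Omega> \<Longrightarrow> \<alpha> \<in> \<A> \<Longrightarrow> a x \<alpha> \<in> sym_matrices"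
    and cont_f: "continuous_on (closure \<Omega> \<times> \<A>) (\<lambda>(x, \<alpha>). f x \<alpha>)"
begin

abbreviation H :: "real^'d \<Rightarrow> real^'d^'d \<Rightarrow> real" where
  "H \<equiv> hamiltonian \<A> a f"

text \<open>A bound for the coefficients, which exists by compactness; it becomes the Lipschitz
  constant of H in the matrix variable, uniformly in x.\<close>

definition a_bound :: real where
  "a_bound = (SOME C. 0 \<le> C \<and> (\<forall>x\<in>closure \<Omega>. \<forall>\<alpha>\<in>\<A>. norm (a x \<alpha>) \<le> C))"

lemma compact_data: "compact (closure \<Omega> \<times> \<A>)"
  using bounded_dom compact_controls by (intro compact_Times) auto

lemma a_bound: "0 \<le> a_bound" "x \<in> closure \<Omega> \<Longrightarrow> \<alpha> \<in> \<A> \<Longrightarrow> norm (a x \<alpha>) \<le> a_bound"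
proof -
  have "bounded ((\<lambda>(x, \<alpha>). a x \<alpha>) ` (closure \<Omega> \<times> \<A>))"
    using compact_continuous_image[OF cont_a compact_data] by (rule compact_imp_bounded)
  then obtain C where C: "\<And>x \<alpha>. x \<in> closure \<Omega> \<Longrightarrow> \<alpha> \<in> \<A> \<Longrightarrow> norm (a x \<alpha>) \<le> C"
    unfolding bounded_iff by fast
  have "\<exists>C. 0 \<le> C \<and> (\<forall>x\<in>closure \<Omega>. \<forall>\<alpha>\<in>\<A>. norm (a x \<alpha>) \<le> C)"
    using C by (intro exI[of _ "\<bar>C\<bar>"]) (auto intro: order_trans[OF _ abs_ge_self])
  from someI_ex[OF this]
  show "0 \<le> a_bound" "x \<in> closure \<Omega> \<Longrightarrow> \<alpha> \<in> \<A> \<Longrightarrow> norm (a x \<alpha>) \<le> a_bound"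
    unfolding a_bound_def by auto
qed

lemma inner_a_le:
  assumes "x \<in> closure \<Omega>" "\<alpha> \<in> \<A>"
  shows "- a x \<alpha> \<bullet> M \<le> a_bound * norm M"
proof -
  have "- a x \<alpha> \<bullet> M \<le> norm (a x \<alpha>) * norm M"
    using norm_cauchy_schwarz[of "- a x \<alpha>" M] by simp
  also have "\<dots> \<le> a_bound * norm M"
    using a_bound(2)[OF assms] by (intro mult_right_mono) auto
  finally show ?thesis .
qed

lemma H_bdd_above:
  assumes x: "x \<in> closure \<Omega>"
  shows "bdd_above ((\<lambda>\<alpha>. - a x \<alpha> \<bullet> M - f x \<alpha>) ` \<A>)"
proof -
  have "bounded ((\<lambda>(x, \<alpha>). f x \<alpha>) ` (closure \<Omega> \<times> \<A>))"
    using compact_continuous_image[OF cont_f compact_data] by (rule compact_imp_bounded)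
  then obtain K where K: "\<And>x \<alpha>. x \<in> closure \<Omega> \<Longrightarrow> \<alpha> \<in> \<A> \<Longrightarrow> norm (f x \<alpha>) \<le> K"
    unfolding bounded_iff by fast
  show ?thesis
  proof (rule bdd_aboveI2)
    fix \<alpha> assume \<alpha>: "\<alpha> \<in> \<A>"
    show "- a x \<alpha> \<bullet> M - f x \<alpha> \<le> a_bound * norm M + K"
      using inner_a_le[OF x \<alpha>, of M] K[OF x \<alpha>] unfolding real_norm_def by linarith
  qed
qed

lemma H_upper:
  assumes "x \<in> closure \<Omega>" "\<alpha> \<in> \<A>"
  shows "- a x \<alpha> \<bullet> M - f x \<alpha> \<le> H x M"
  unfolding hamiltonian_def using assms H_bdd_above by (intro cSUP_upper)

lemma H_least:
  assumes "\<And>\<alpha>. \<alpha> \<in> \<A> \<Longrightarrow> - a x \<alpha> \<bullet> M - f x \<alpha> \<le> c"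
  shows "H x M \<le> c"
  unfolding hamiltonian_def using assms controls_nonempty by (intro cSUP_least)

text \<open>Each affine function under the supremum has a gradient of norm at most
  \<open>a_bound\<close>, and the supremum inherits the Lipschitz estimate.\<close>

lemma H_diff_le:
  assumes x: "x \<in> closure \<Omega>"
  shows "H x M - H x N \<le> a_bound * norm (M - N)"
proof -
  have "H x M \<le> H x N + a_bound * norm (M - N)"
  proof (rule H_least)
    fix \<alpha> assume \<alpha>: "\<alpha> \<in> \<A>"
    have "- a x \<alpha> \<bullet> M = - a x \<alpha> \<bullet> N + - a x \<alpha> \<bullet> (M - N)" by (simp add: inner_diff_right)
    then show "- a x \<alpha> \<bullet> M - f x \<alpha> \<le> H x N + a_bound * norm (M - N)"
      using H_upper[OF x \<alpha>, of N] inner_a_le[OF x \<alpha>, of "M - N"] by linarith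
  qed
  then show ?thesis by simp
qed

lemma H_lipschitz:
  assumes "x \<in> closure \<Omega>"
  shows "\<bar>H x M - H x N\<bar> \<le> a_bound * norm (M - N)"
  using H_diff_le[OF assms, of M N] H_diff_le[OF assms, of N M] by (simp add: norm_minus_commute)

lemma convex_H:
  assumes x: "x \<in> closure \<Omega>"
  shows "convex_on UNIV (H x)"
proof (rule convex_onI)
  fix t :: real and M N assume t: "0 < t" "t < 1"
  show "H x ((1 - t) *\<^sub>R M + t *\<^sub>R N) \<le> (1 - t) * H x M + t * H x N"
  proof (rule H_least)
    fix \<alpha> assume \<alpha>: "\<alpha> \<in> \<A>"
    have "- a x \<alpha> \<bullet> ((1 - t) *\<^sub>R M + t *\<^sub>R N) - f x \<alpha> =
        (1 - t) * (- a x \<alpha> \<bullet> M - f x \<alpha>) + t * (- a x \<alpha> \<bullet> N - f x \<alpha>)"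
      by (simp add: inner_add_right algebra_simps)
    also have "\<dots> \<le> (1 - t) * H x M + t * H x N"
      using t H_upper[OF x \<alpha>] by (intro add_mono mult_left_mono) auto
    finally show "- a x \<alpha> \<bullet> ((1 - t) *\<^sub>R M + t *\<^sub>R N) - f x \<alpha> \<le> (1 - t) * H x M + t * H x N" .
  qed
qed simp

text \<open>The coefficients are symmetric, so no function under the supremum sees N. This later
  forces the values of A, found among all matrices, to be symmetric.\<close>

lemma H_add_antisymmetric:
  assumes x: "x \<in> closure \<Omega>" and N: "transpose N = - N"
  shows "H x (M + N) = H x M"
  unfolding hamiltonian_def
  using inner_symmetric_antisymmetric[OF sym_a[OF x] N] by (simp add: inner_add_right cong: SUP_cong_simp)

text \<open>As a supremum of continuous functions, \<open>H\<close> is lower semicontinuous, hence Borel.\<close>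

lemma H_measurable:
  assumes X: "X \<in> borel_measurable (lebesgue_on \<Omega>)"
  shows "(\<lambda>x. H x (X x)) \<in> borel_measurable (lebesgue_on \<Omega>)"
proof (rule borel_measurable_iff_greater[THEN iffD2], rule allI)
  fix c :: real
  let ?U = "\<lambda>\<alpha>. {p \<in> \<Omega> \<times> UNIV. - a (fst p) \<alpha> \<bullet> snd p - f (fst p) \<alpha> > c}"
  have "open (?U \<alpha>)" if \<alpha>: "\<alpha> \<in> \<A>" for \<alpha>
  proof -
    have op: "open (\<Omega> \<times> (UNIV :: (real^'d^'d) set))" using open_dom by (intro open_Times) auto
    have pair: "continuous_on (\<Omega> \<times> (UNIV :: (real^'d^'d) set)) (\<lambda>p. (fst p, \<alpha>))"
      by (intro continuous_intros)
    have sub: "(\<lambda>p. (fst p, \<alpha>)) ` (\<Omega> \<times> (UNIV :: (real^'d^'d) set)) \<subseteq> closure \<Omega> \<times> \<A>"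
      using \<alpha> closure_subset[of \<Omega>] by auto
    have "continuous_on (\<Omega> \<times> (UNIV :: (real^'d^'d) set)) (\<lambda>p. a (fst p) \<alpha>)"
      "continuous_on (\<Omega> \<times> (UNIV :: (real^'d^'d) set)) (\<lambda>p. f (fst p) \<alpha>)"
      using continuous_on_compose2[OF cont_a pair sub] continuous_on_compose2[OF cont_f pair sub] by simp_all
    then have "continuous_on (\<Omega> \<times> UNIV) (\<lambda>p. - a (fst p) \<alpha> \<bullet> snd p - f (fst p) \<alpha>)"
      by (intro continuous_intros)
    from continuous_open_preimage[OF this op open_greaterThan[of c]]
    show ?thesis by (simp add: vimage_def Int_def greaterThan_def)
  qed
  \<comment> \<open>The union over the controls may be uncountable; it is Borel because every set in
    it is open.\<close>
  then have U: "(\<Union>\<alpha>\<in>\<A>. ?U \<alpha>) \<in> sets borel" by (intro borel_open open_UN) auto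
  have "(\<lambda>x. x) \<in> borel_measurable (lebesgue_on \<Omega>)"
    by (intro measurable_restrict_space1 measurable_completion) simp
  then have "(\<lambda>x. (x, X x)) \<in> borel_measurable (lebesgue_on \<Omega>)"
    using X by (rule borel_measurable_Pair)
  from measurable_sets[OF this U]
  have "(\<lambda>x. (x, X x)) -` (\<Union>\<alpha>\<in>\<A>. ?U \<alpha>) \<inter> space (lebesgue_on \<Omega>) \<in> sets (lebesgue_on \<Omega>)" .
  also have "(\<lambda>x. (x, X x)) -` (\<Union>\<alpha>\<in>\<A>. ?U \<alpha>) \<inter> space (lebesgue_on \<Omega>) =
      {x \<in> space (lebesgue_on \<Omega>). c < H x (X x)}"
  proof -
    have "c < H x (X x) \<longleftrightarrow> (\<exists>\<alpha>\<in>\<A>. c < - a x \<alpha> \<bullet> X x - f x \<alpha>)" if "x \<in> \<Omega>" for x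
      unfolding hamiltonian_def using that closure_subset[of \<Omega>] controls_nonempty
      by (intro less_cSUP_iff H_bdd_above) auto
    then show ?thesis by auto
  qed
  finally show "{x \<in> space (lebesgue_on \<Omega>). c < H x (X x)} \<in> sets (lebesgue_on \<Omega>)" .
qed

lemma H_increment_bound:
  assumes "x \<in> \<Omega>"
  shows "\<bar>H x (M + N) - H x M\<bar> \<le> a_bound * norm N"
  using H_lipschitz[of x "M + N" M] assms closure_subset[of \<Omega>] by auto

text \<open>The Lipschitz estimate controls the increment by \<open>a_bound\<close> times the norm
  of W. Since X is merely measurable here, the two terms need not be integrable separately.\<close>

lemma H_increment_integrable:
  assumes X: "X \<in> borel_measurable (lebesgue_on \<Omega>)" and W: "integrable (lebesgue_on \<Omega>) W"
  shows "integrable (lebesgue_on \<Omega>) (\<lambda>x. H x (X x + W x) - H x (X x))"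
proof (rule Bochner_Integration.integrable_bound)
  show "integrable (lebesgue_on \<Omega>) (\<lambda>x. a_bound * norm (W x))" using W by simp
  show "(\<lambda>x. H x (X x + W x) - H x (X x)) \<in> borel_measurable (lebesgue_on \<Omega>)"
    using X W by (intro borel_measurable_diff H_measurable borel_measurable_add) auto
  show "AE x in lebesgue_on \<Omega>. norm (H x (X x + W x) - H x (X x)) \<le> norm (a_bound * norm (W x))"
    using H_increment_bound a_bound(1) by (intro AE_I2) (simp add: abs_mult)
qed

text \<open>
  For \<open>\<mu> \<ge> t\<close> this is the monotonicity of difference quotients of a convex function; for
  \<open>\<mu> < t\<close> both increments are negligible by Lipschitz continuity.
\<close>

lemma H_increment_scale:
  assumes x: "x \<in> \<Omega>" and \<mu>: "0 \<le> \<mu>" and t: "0 < t"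
  shows "\<mu> * (H x (M + t *\<^sub>R N) - H x M) \<le>
    t * (H x (M + \<mu> *\<^sub>R N) - H x M) + 2 * a_bound * t\<^sup>2 * norm N"
proof (cases "t \<le> \<mu>")
  case True
  have x': "x \<in> closure \<Omega>" using x closure_subset by blast
  \<comment> \<open>M + t N is the point at the fraction s of the segment from M to M + \<mu>
    N.\<close>
  define s where "s = t / \<mu>"
  have s: "0 \<le> s" "s \<le> 1" "\<mu> * s = t" using True t by (auto simp: s_def)
  have "M + t *\<^sub>R N = (1 - s) *\<^sub>R M + s *\<^sub>R (M + \<mu> *\<^sub>R N)"
    using s(3) by (simp add: algebra_simps)
  then have "H x (M + t *\<^sub>R N) \<le> (1 - s) * H x M + s * H x (M + \<mu> *\<^sub>R N)"
    using convex_onD[OF convex_H[OF x'] s(1,2), of M "M + \<mu> *\<^sub>R N"] by simp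
  then have "H x (M + t *\<^sub>R N) - H x M \<le> s * (H x (M + \<mu> *\<^sub>R N) - H x M)"
    by (simp add: algebra_simps)
  then have "\<mu> * (H x (M + t *\<^sub>R N) - H x M) \<le> \<mu> * (s * (H x (M + \<mu> *\<^sub>R N) - H x M))"
    using \<mu> by (rule mult_left_mono)
  also have "\<dots> = t * (H x (M + \<mu> *\<^sub>R N) - H x M)" using s(3) by (simp flip: mult.assoc)
  finally show ?thesis using a_bound(1) by (simp add: add_increasing2)
next
  case False
  define n where "n = a_bound * norm N"
  have n: "0 \<le> n" using a_bound(1) by (simp add: n_def)
  have "H x (M + t *\<^sub>R N) - H x M \<le> t * n"
    using H_increment_bound[OF x, of M "t *\<^sub>R N"] t by (simp add: n_def mult_ac)
  then have "\<mu> * (H x (M + t *\<^sub>R N) - H x M) \<le> \<mu> * (t * n)"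
    using \<mu> by (rule mult_left_mono)
  moreover have "t * (- (\<mu> * n)) \<le> t * (H x (M + \<mu> *\<^sub>R N) - H x M)"
    using H_increment_bound[OF x, of M "\<mu> *\<^sub>R N"] t \<mu> by (intro mult_left_mono) (auto simp: n_def mult_ac abs_le_iff)
  \<comment> \<open>Both Lipschitz bounds have size \<mu> t n, which is at most t^2 n because \<mu>
    < t; together they account for the factor 2 in the error.\<close>
  moreover have "\<mu> * (t * n) \<le> t * (t * n)"
    using False t n by (intro mult_right_mono) auto
  ultimately show ?thesis
    by (simp add: n_def power2_eq_square algebra_simps)
qed

text \<open>Free of m and G: a linear functional on a subspace of L^1 that lies below the convex
  functional \<Phi> is integration against a measurable selection from the subdifferential.
  Lipschitz continuity of H bounds the extended functional by \<open>a_bound\<close> times the L^1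
  norm, which makes the duality applicable.\<close>

lemma subdifferential_representation:
  assumes X: "X \<in> borel_measurable (lebesgue_on \<Omega>)"
    and \<Gamma>: "subspace (\<Gamma> :: ((real^'d \<Rightarrow> real^'d^'d) \<times> real) set)"
    and below: "\<And>W r. (W, r) \<in> \<Gamma> \<Longrightarrow>
      integrable (lebesgue_on \<Omega>) W \<and> r \<le> (LINT x|lebesgue_on \<Omega>. H x (X x + W x) - H x (X x))"
  obtains A where "A \<in> Linfty_sym \<Omega>"
    and "AE x in lebesgue_on \<Omega>. A x \<in> partial_subdiff \<A> a f x (X x)"
    and "\<And>W r. (W, r) \<in> \<Gamma> \<Longrightarrow> r = (LINT x|lebesgue_on \<Omega>. A x \<bullet> W x)"
proof -
  let ?M = "lebesgue_on \<Omega>"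
  interpret finite_measure ?M by (rule finite_measure_dom)
  define E where "E = {W :: real^'d \<Rightarrow> real^'d^'d. integrable ?M W}"
  define \<Phi> where "\<Phi> W = (LINT x|?M. H x (X x + W x) - H x (X x))" for W
  have plus_eq: "V + W = (\<lambda>x. V x + W x)" and scale_eq: "c *\<^sub>R W = (\<lambda>x. c *\<^sub>R W x)"
    for V W :: "real^'d \<Rightarrow> real^'d^'d" and c
    by (auto simp: scaleR_fun_def fun_eq_iff)
  have E: "subspace E"
    by (rule subspaceI) (auto simp: E_def plus_eq scale_eq zero_fun_def)
  have cl: "x \<in> closure \<Omega>" if "x \<in> \<Omega>" for x using that closure_subset by blast
  have \<Phi>: "convex_on E \<Phi>"
  proof (rule convex_onI)
    show "convex E" using E by (rule subspace_imp_convex)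
    fix t :: real and V W assume t: "0 < t" "t < 1" and VW: "V \<in> E" "W \<in> E"
    then have int: "integrable ?M V" "integrable ?M W" by (auto simp: E_def)
    note inc = H_increment_integrable[OF X int(1)] H_increment_integrable[OF X int(2)]
    have "\<Phi> ((1 - t) *\<^sub>R V + t *\<^sub>R W) \<le> (LINT x|?M. (1 - t) * (H x (X x + V x) - H x (X x)) + t * (H x (X x + W x) - H x (X x)))"
      unfolding \<Phi>_def
    proof (rule integral_mono)
      have "(1 - t) *\<^sub>R V + t *\<^sub>R W \<in> E" using VW E by (intro subspace_add subspace_scale)
      then show "integrable ?M (\<lambda>x. H x (X x + ((1 - t) *\<^sub>R V + t *\<^sub>R W) x) - H x (X x))"
        unfolding E_def mem_Collect_eq by (rule H_increment_integrable[OF X])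
      show "integrable ?M (\<lambda>x. (1 - t) * (H x (X x + V x) - H x (X x)) + t * (H x (X x + W x) - H x (X x)))"
        using inc by simp
      fix x assume "x \<in> space ?M"
      then have x: "x \<in> closure \<Omega>" using cl by simp
      have "X x + ((1 - t) *\<^sub>R V + t *\<^sub>R W) x = (1 - t) *\<^sub>R (X x + V x) + t *\<^sub>R (X x + W x)"
        by (simp add: scaleR_fun_def algebra_simps)
      then have "H x (X x + ((1 - t) *\<^sub>R V + t *\<^sub>R W) x) \<le> (1 - t) * H x (X x + V x) + t * H x (X x + W x)"
        using convex_onD[OF convex_H[OF x], of t "X x + V x" "X x + W x"] t by simp
      then show "H x (X x + ((1 - t) *\<^sub>R V + t *\<^sub>R W) x) - H x (X x) \<le>
          (1 - t) * (H x (X x + V x) - H x (X x)) + t * (H x (X x + W x) - H x (X x))"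
        by (simp add: algebra_simps)
    qed
    also have "\<dots> = (1 - t) * \<Phi> V + t * \<Phi> W"
      unfolding \<Phi>_def using inc by (subst Bochner_Integration.integral_add) auto
    finally show "\<Phi> ((1 - t) *\<^sub>R V + t *\<^sub>R W) \<le> (1 - t) * \<Phi> V + t * \<Phi> W" .
  qed
  have "W \<in> E \<and> r \<le> \<Phi> W" if "(W, r) \<in> \<Gamma>" for W r
    using below[OF that] by (simp add: E_def \<Phi>_def)
  from Hahn_Banach_convex[OF E \<Phi> \<Gamma> this]
  obtain L where L_le: "\<And>W. W \<in> E \<Longrightarrow> L W \<le> \<Phi> W"
    and L_add: "\<And>V W. V \<in> E \<Longrightarrow> W \<in> E \<Longrightarrow> L (V + W) = L V + L W"
    and L_scale: "\<And>c W. W \<in> E \<Longrightarrow> L (c *\<^sub>R W) = c * L W"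
    and L_\<Gamma>: "\<And>W r. (W, r) \<in> \<Gamma> \<Longrightarrow> L W = r"
    by blast
  have L_bound: "L W \<le> a_bound * (LINT x|?M. norm (W x))" if "W \<in> E" for W
  proof -
    have W: "integrable ?M W" using that by (simp add: E_def)
    have "\<Phi> W \<le> (LINT x|?M. a_bound * norm (W x))"
      unfolding \<Phi>_def
    proof (rule integral_mono)
      show "H x (X x + W x) - H x (X x) \<le> a_bound * norm (W x)" if "x \<in> space ?M" for x
        using H_increment_bound[of x "X x" "W x"] that by (simp add: abs_le_iff)
    qed (use W in \<open>auto intro: H_increment_integrable[OF X]\<close>)
    then show ?thesis using L_le[OF \<open>W \<in> E\<close>] by simp
  qed
  have L_abs: "\<bar>L W\<bar> \<le> a_bound * (LINT x|?M. norm (W x))" if "integrable ?M W" for W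
  proof -
    have W: "W \<in> E" using that by (simp add: E_def)
    have "(-1) *\<^sub>R W \<in> E" using E W by (rule subspace_scale)
    from L_bound[OF W] L_bound[OF this] L_scale[OF W, of "-1"]
    show ?thesis by (simp add: scaleR_fun_def abs_le_iff)
  qed
  obtain A K where A: "A \<in> borel_measurable ?M" "\<And>x. norm (A x) \<le> K"
    and L_A: "\<And>W. integrable ?M W \<Longrightarrow> L W = (LINT x|?M. A x \<bullet> W x)"
  proof (rule L1_dual_representation[OF finite_measure_dom, of L a_bound])
    show "L (\<lambda>x. V x + W x) = L V + L W" if "integrable ?M V" "integrable ?M W" for V W
      using L_add[of V W] that by (simp add: E_def plus_eq)
    show "L (\<lambda>x. c *\<^sub>R W x) = c * L W" if "integrable ?M W" for c W
      using L_scale[of W c] that by (simp add: E_def scale_eq)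
  qed (use L_abs in auto)
  \<comment> \<open>The exceptional null set depends on N. It suffices to collect those of a
    countable dense set of matrices, since both sides of the inequality are continuous in N.\<close>
  have "AE x in ?M. 0 \<le> (H x (X x + N) - H x (X x)) - A x \<bullet> N" for N
  proof (rule AE_nonneg_if_set_integrals_nonneg)
    have N: "integrable ?M (\<lambda>x. N)" by simp
    have AN: "integrable ?M (\<lambda>x. A x \<bullet> N)"
    proof (rule integrable_const_bound)
      show "AE x in ?M. norm (A x \<bullet> N) \<le> K * norm N"
        using A(2) by (intro AE_I2) (metis Cauchy_Schwarz_ineq2 mult_right_mono norm_ge_zero order_trans real_norm_def)
    qed (use A(1) in measurable)
    show int: "integrable ?M (\<lambda>x. (H x (X x + N) - H x (X x)) - A x \<bullet> N)"
      using H_increment_integrable[OF X N] AN by simp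
    fix S assume S: "S \<in> sets ?M"
    \<comment> \<open>Off S this perturbation is zero and so is the increment, which localises the
      inequality between L and \<Phi> to S.\<close>
    let ?W = "\<lambda>x. indicator S x *\<^sub>R N"
    have W: "integrable ?M ?W" using S by (intro integrable_mult_indicator N)
    have "integrable ?M (\<lambda>x. indicator S x *\<^sub>R (A x \<bullet> N))" using S AN by (rule integrable_mult_indicator)
    then have AW: "integrable ?M (\<lambda>x. A x \<bullet> ?W x)" by simp
    have "0 \<le> \<Phi> ?W - L ?W" using L_le[of ?W] W by (simp add: E_def)
    also have "\<dots> = (LINT x|?M. (H x (X x + ?W x) - H x (X x)) - A x \<bullet> ?W x)"
      unfolding \<Phi>_def L_A[OF W]
      by (rule Bochner_Integration.integral_diff[symmetric, OF H_increment_integrable[OF X W] AW])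
    also have "\<dots> = (LINT x|?M. indicator S x * ((H x (X x + N) - H x (X x)) - A x \<bullet> N))"
      by (intro Bochner_Integration.integral_cong) (auto simp: indicator_def)
    finally show "0 \<le> (LINT x|?M. indicator S x * ((H x (X x + N) - H x (X x)) - A x \<bullet> N))" .
  qed
  moreover obtain D :: "(real^'d^'d) set" where D: "countable D" "\<And>U. open U \<Longrightarrow> U \<noteq> {} \<Longrightarrow> \<exists>d\<in>D. d \<in> U"
    using countable_dense_setE by blast
  ultimately have "AE x in ?M. \<forall>N\<in>D. 0 \<le> (H x (X x + N) - H x (X x)) - A x \<bullet> N"
    by (subst AE_ball_countable) auto
  then have sub: "AE x in ?M. \<forall>N. H x (X x) + A x \<bullet> N \<le> H x (X x + N)"
    using AE_space
  proof eventually_elim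
    case (elim x)
    then have x: "x \<in> closure \<Omega>" using cl by simp
    have cont: "continuous_on UNIV (H x)"
      using convex_H[OF x] by (intro convex_on_continuous) auto
    let ?U = "{N. (H x (X x + N) - H x (X x)) - A x \<bullet> N < 0}"
    have "open ?U"
      by (intro open_Collect_less continuous_intros continuous_on_compose2[OF cont]) auto
    moreover have "\<not> (\<exists>d\<in>D. d \<in> ?U)" using elim(1) by fastforce
    ultimately have "?U = {}" using D(2) by blast
    show ?case
    proof
      fix N
      have "N \<notin> ?U" unfolding \<open>?U = {}\<close> by simp
      then show "H x (X x) + A x \<bullet> N \<le> H x (X x + N)" by simp
    qed
  qed
  have A_sym: "AE x in ?M. A x \<in> sym_matrices"
    using sub AE_space
  proof eventually_elim
    case (elim x)
    then have x: "x \<in> closure \<Omega>" using cl by simp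
    \<comment> \<open>Moving by the antisymmetric matrix \<open>?N\<close> leaves H unchanged, so
      the subgradient inequality gives \<open>A x \<bullet> ?N \<le> 0\<close>; but
      \<open>?N \<bullet> ?N\<close> is twice this number.\<close>
    let ?N = "A x - transpose (A x)"
    have N: "transpose ?N = - ?N" by (simp add: transpose_diff)
    have "A x \<bullet> ?N \<le> 0" using spec[OF elim(1), of ?N] H_add_antisymmetric[OF x N, of "X x"] by linarith
    moreover have "transpose (A x) \<bullet> ?N = - (A x \<bullet> ?N)"
      using inner_transpose[of "A x" ?N] unfolding N inner_minus_right by linarith
    ultimately have "?N \<bullet> ?N \<le> 0" by (simp only: inner_diff_left)
    then have "?N \<bullet> ?N = 0" using inner_ge_zero[of ?N] by linarith
    then have "?N = 0" unfolding inner_eq_zero_iff .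
    then show ?case by (simp add: sym_matrices_def)
  qed
  show ?thesis
  proof (rule that)
    show "A \<in> Linfty_sym \<Omega>" using A A_sym by (auto simp: Linfty_sym_def)
    show "AE x in ?M. A x \<in> partial_subdiff \<A> a f x (X x)"
      using sub A_sym
    proof eventually_elim
      case (elim x)
      show ?case
        unfolding partial_subdiff_def
      proof (intro CollectI conjI ballI)
        show "A x \<in> sym_matrices" by (rule elim(2))
        show "H x (X x) + A x \<bullet> (M' - X x) \<le> H x M'" for M'
          using spec[OF elim(1), of "M' - X x"] by simp
      qed
    qed
    show "r = (LINT x|?M. A x \<bullet> W x)" if "(W, r) \<in> \<Gamma>" for W r
      using L_\<Gamma>[OF that] L_A below[OF that] by simp
  qed
qed

end

subsection \<open>Equivalence of the two problems\<close>

context hamiltonian_data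
begin

lemma H_op_increment_L2:
  assumes u: "u \<in> V_space \<Omega>" and v: "v \<in> V_space \<Omega>"
  shows "(\<lambda>x. hamiltonian_op \<Omega> \<A> a f v x - hamiltonian_op \<Omega> \<A> a f u x) \<in> L2 \<Omega>"
proof (rule L2_bound)
  let ?w = "\<lambda>x. v x + (-1) * u x"
  \<comment> \<open>The summand 0 puts the multiple into the form v + c w of
    \<open>L2_add_scale\<close>.\<close>
  show "(\<lambda>x. 0 + a_bound * norm (weak_hessian \<Omega> ?w x)) \<in> L2 \<Omega>"
    by (intro L2_add_scale norm_weak_hessian_L2 V_space_add_scale u v bounded_L2[of _ 0]) auto
  show "(\<lambda>x. hamiltonian_op \<Omega> \<A> a f v x - hamiltonian_op \<Omega> \<A> a f u x) \<in> borel_measurable (lebesgue_on \<Omega>)"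
    unfolding hamiltonian_op_def
    by (intro borel_measurable_diff H_measurable weak_hessian_measurable u v)
  show "AE x in lebesgue_on \<Omega>. \<bar>hamiltonian_op \<Omega> \<A> a f v x - hamiltonian_op \<Omega> \<A> a f u x\<bar>
      \<le> \<bar>0 + a_bound * norm (weak_hessian \<Omega> ?w x)\<bar>"
    using weak_hessian_add_scale[OF v u, of "-1"] AE_space
  proof eventually_elim
    case (elim x)
    then show ?case
      using H_increment_bound[of x "weak_hessian \<Omega> u x" "weak_hessian \<Omega> v x - weak_hessian \<Omega> u x"] a_bound(1)
      by (simp add: hamiltonian_op_def)
  qed
qed

lemma DH_inner_L2:
  assumes A: "A \<in> Linfty_sym \<Omega>" and v: "v \<in> V_space \<Omega>"
  shows "(\<lambda>x. A x \<bullet> weak_hessian \<Omega> v x) \<in> L2 \<Omega>"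
proof -
  obtain K where K: "AE x in lebesgue_on \<Omega>. norm (A x) \<le> K"
    and A_meas: "A \<in> borel_measurable (lebesgue_on \<Omega>)"
    using A by (auto simp: Linfty_sym_def)
  show ?thesis
  proof (rule L2_bound)
    show "(\<lambda>x. 0 + K * norm (weak_hessian \<Omega> v x)) \<in> L2 \<Omega>"
      by (intro L2_add_scale norm_weak_hessian_L2 v bounded_L2[of _ 0]) auto
    show "(\<lambda>x. A x \<bullet> weak_hessian \<Omega> v x) \<in> borel_measurable (lebesgue_on \<Omega>)"
      by (intro borel_measurable_inner A_meas weak_hessian_measurable v)
    show "AE x in lebesgue_on \<Omega>. \<bar>A x \<bullet> weak_hessian \<Omega> v x\<bar> \<le> \<bar>0 + K * norm (weak_hessian \<Omega> v x)\<bar>"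
      using K
    proof eventually_elim
      case (elim x)
      have "\<bar>A x \<bullet> weak_hessian \<Omega> v x\<bar> \<le> norm (A x) * norm (weak_hessian \<Omega> v x)"
        by (rule Cauchy_Schwarz_ineq2)
      also have "\<dots> \<le> K * norm (weak_hessian \<Omega> v x)"
        using elim by (intro mult_right_mono) auto
      finally show ?case by simp
    qed
  qed
qed

lemma V_space_zero:
  assumes "u \<in> V_space \<Omega>"
  shows "(\<lambda>x. 0) \<in> V_space \<Omega>"
  using V_space_add_scale[OF assms assms, of "-1"] by simp

text \<open>The zero function is the sum of two copies of itself, so its Hessian equals twice itself
  almost everywhere.\<close>

lemma weak_hessian_zero:
  assumes "u \<in> V_space \<Omega>"
  shows "AE x in lebesgue_on \<Omega>. weak_hessian \<Omega> (\<lambda>x. 0) x = 0"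
  using weak_hessian_add_scale[OF V_space_zero[OF assms] V_space_zero[OF assms], of 1]
  by simp

lemma PDI_imp_VI:
  assumes PDI: "PDI_solution \<Omega> \<A> a f F G u m" and m_nonneg: "AE x in lebesgue_on \<Omega>. 0 \<le> m x"
  shows "VI_solution \<Omega> \<A> a f F G u m"
proof -
  obtain abar where u: "u \<in> V_space \<Omega>" and m: "m \<in> L2 \<Omega>"
    and HJB: "AE x in lebesgue_on \<Omega>. hamiltonian_op \<Omega> \<A> a f u x = F m x"
    and abar: "(\<lambda>x. - abar x) \<in> DH \<Omega> \<A> a f u"
    and G: "\<And>v. v \<in> V_space \<Omega> \<Longrightarrow> L2_inner \<Omega> m (\<lambda>x. - abar x \<bullet> weak_hessian \<Omega> v x) = G v"
    using PDI by (auto simp: PDI_solution_def)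
  have A: "(\<lambda>x. - abar x) \<in> Linfty_sym \<Omega>"
    and sub: "AE x in lebesgue_on \<Omega>. - abar x \<in> partial_subdiff \<A> a f x (weak_hessian \<Omega> u x)"
    using abar by (auto simp: DH_def)
  have "G (\<lambda>x. v x - u x) \<le>
      L2_inner \<Omega> m (\<lambda>x. hamiltonian_op \<Omega> \<A> a f v x - hamiltonian_op \<Omega> \<A> a f u x)"
    if v: "v \<in> V_space \<Omega>" for v
  proof -
    let ?w = "\<lambda>x. v x - u x"
    have w: "?w \<in> V_space \<Omega>" using V_space_add_scale[OF v u, of "-1"] by simp
    have hess: "AE x in lebesgue_on \<Omega>. weak_hessian \<Omega> ?w x = weak_hessian \<Omega> v x - weak_hessian \<Omega> u x"
      using weak_hessian_add_scale[OF v u, of "-1"] by simp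
    have "G ?w = (LINT x|lebesgue_on \<Omega>. m x * (- abar x \<bullet> weak_hessian \<Omega> ?w x))"
      using G[OF w] by (simp add: L2_inner_def)
    also have "\<dots> \<le> (LINT x|lebesgue_on \<Omega>. m x * (hamiltonian_op \<Omega> \<A> a f v x - hamiltonian_op \<Omega> \<A> a f u x))"
    proof (rule integral_mono_AE)
      show "integrable (lebesgue_on \<Omega>) (\<lambda>x. m x * (- abar x \<bullet> weak_hessian \<Omega> ?w x))"
        using m DH_inner_L2[OF A w] by (rule L2_mult_integrable)
      show "integrable (lebesgue_on \<Omega>) (\<lambda>x. m x * (hamiltonian_op \<Omega> \<A> a f v x - hamiltonian_op \<Omega> \<A> a f u x))"
        using m H_op_increment_L2[OF u v] by (rule L2_mult_integrable)
      \<comment> \<open>Symmetry of the Hessian of v enters because the subdifferential tests with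
        symmetric matrices only.\<close>
      show "AE x in lebesgue_on \<Omega>. m x * (- abar x \<bullet> weak_hessian \<Omega> ?w x) \<le>
          m x * (hamiltonian_op \<Omega> \<A> a f v x - hamiltonian_op \<Omega> \<A> a f u x)"
        using m_nonneg hess sub weak_hessian_symmetric[OF v]
      proof eventually_elim
        case (elim x)
        have "H x (weak_hessian \<Omega> u x) + - abar x \<bullet> (weak_hessian \<Omega> v x - weak_hessian \<Omega> u x)
            \<le> H x (weak_hessian \<Omega> v x)"
          using elim(3,4) unfolding partial_subdiff_def by blast
        then have "- abar x \<bullet> weak_hessian \<Omega> ?w x \<le> hamiltonian_op \<Omega> \<A> a f v x - hamiltonian_op \<Omega> \<A> a f u x"
          unfolding elim(2) hamiltonian_op_def by linarith
        then show ?case using elim(1) by (rule mult_left_mono)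
      qed
    qed
    finally show ?thesis by (simp add: L2_inner_def)
  qed
  then show ?thesis
    using u m m_nonneg HJB by (simp add: VI_solution_def L2_nonneg_def)
qed

text \<open>\<open>H_increment_scale\<close> with \<mu> = m(x) moves the factor m inside H, at the
  cost of an integrable error of order t^2.\<close>

lemma VI_linearised:
  assumes VI: "VI_solution \<Omega> \<A> a f F G u m" and G: "G \<in> V_dual \<Omega>" and w: "w \<in> V_space \<Omega>"
  shows "G w \<le> (LINT x|lebesgue_on \<Omega>.
    H x (weak_hessian \<Omega> u x + m x *\<^sub>R weak_hessian \<Omega> w x) - H x (weak_hessian \<Omega> u x))"
    (is "_ \<le> ?\<Phi>")
proof (rule field_le_epsilon)
  fix e :: real assume e: "0 < e"
  have u: "u \<in> V_space \<Omega>" and m: "m \<in> L2 \<Omega>" and m_nonneg: "AE x in lebesgue_on \<Omega>. 0 \<le> m x"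
    and VI': "\<And>v. v \<in> V_space \<Omega> \<Longrightarrow> G (\<lambda>x. v x - u x) \<le>
        L2_inner \<Omega> m (\<lambda>x. hamiltonian_op \<Omega> \<A> a f v x - hamiltonian_op \<Omega> \<A> a f u x)"
    using VI by (auto simp: VI_solution_def L2_nonneg_def)
  let ?X = "weak_hessian \<Omega> u" and ?W = "weak_hessian \<Omega> w"
  have W: "integrable (lebesgue_on \<Omega>) (\<lambda>x. norm (?W x))"
    using norm_weak_hessian_L2[OF w] by (rule L2_integrable)
  define I where "I = 2 * a_bound * (LINT x|lebesgue_on \<Omega>. norm (?W x))"
  have I: "0 \<le> I" unfolding I_def using a_bound(1) by simp
  \<comment> \<open>With I + 1 in the denominator the case I = 0 is included, and the error I t that
    remains after division by t is at most e.\<close>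
  define t where "t = e / (I + 1)"
  have t: "0 < t" "I * t \<le> e" using e I by (auto simp: t_def field_simps)
  let ?v = "\<lambda>x. u x + t * w x"
  have v: "?v \<in> V_space \<Omega>" using u w by (rule V_space_add_scale)
  have mW: "integrable (lebesgue_on \<Omega>) (\<lambda>x. m x *\<^sub>R ?W x)"
  proof (rule Bochner_Integration.integrable_bound)
    show "integrable (lebesgue_on \<Omega>) (\<lambda>x. m x * norm (?W x))"
      using m norm_weak_hessian_L2[OF w] by (rule L2_mult_integrable)
    show "(\<lambda>x. m x *\<^sub>R ?W x) \<in> borel_measurable (lebesgue_on \<Omega>)"
      using L2_D(1)[OF m] weak_hessian_measurable[OF w] by (rule borel_measurable_scaleR)
  qed (simp add: abs_mult)
  note inc = H_increment_integrable[OF weak_hessian_measurable[OF u] mW]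
  have "t * G w = G (\<lambda>x. ?v x - u x)"
    using G w by (simp add: V_dual_def)
  also have "\<dots> \<le> (LINT x|lebesgue_on \<Omega>. m x * (hamiltonian_op \<Omega> \<A> a f ?v x - hamiltonian_op \<Omega> \<A> a f u x))"
    using VI'[OF v] by (simp add: L2_inner_def)
  also have "\<dots> \<le> (LINT x|lebesgue_on \<Omega>. t * (H x (?X x + m x *\<^sub>R ?W x) - H x (?X x)) + 2 * a_bound * t\<^sup>2 * norm (?W x))"
  proof (rule integral_mono_AE)
    show "integrable (lebesgue_on \<Omega>) (\<lambda>x. m x * (hamiltonian_op \<Omega> \<A> a f ?v x - hamiltonian_op \<Omega> \<A> a f u x))"
      using m H_op_increment_L2[OF u v] by (rule L2_mult_integrable)
    show "integrable (lebesgue_on \<Omega>) (\<lambda>x. t * (H x (?X x + m x *\<^sub>R ?W x) - H x (?X x)) + 2 * a_bound * t\<^sup>2 * norm (?W x))"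
      by (intro Bochner_Integration.integrable_add integrable_mult_right inc W)
    show "AE x in lebesgue_on \<Omega>. m x * (hamiltonian_op \<Omega> \<A> a f ?v x - hamiltonian_op \<Omega> \<A> a f u x) \<le>
        t * (H x (?X x + m x *\<^sub>R ?W x) - H x (?X x)) + 2 * a_bound * t\<^sup>2 * norm (?W x)"
      using m_nonneg weak_hessian_add_scale[OF u w, of t] AE_space
    proof eventually_elim
      case (elim x)
      then show ?case
        using H_increment_scale[OF _ elim(1) t(1), of x "?X x" "?W x"]
        unfolding hamiltonian_op_def elim(2) by simp
    qed
  qed
  also have "\<dots> = t * ?\<Phi> + 2 * a_bound * t\<^sup>2 * (LINT x|lebesgue_on \<Omega>. norm (?W x))"
    using inc W by (subst Bochner_Integration.integral_add) auto
  also have "\<dots> = t * (?\<Phi> + I * t)"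
    by (simp add: I_def algebra_simps power2_eq_square)
  finally have "G w \<le> ?\<Phi> + I * t" using t(1) by simp
  then show "G w \<le> ?\<Phi> + e" using t(2) by linarith
qed

lemma VI_imp_PDI:
  assumes VI: "VI_solution \<Omega> \<A> a f F G u m" and G: "G \<in> V_dual \<Omega>"
  shows "PDI_solution \<Omega> \<A> a f F G u m"
proof -
  let ?M = "lebesgue_on \<Omega>"
  have u: "u \<in> V_space \<Omega>" and m: "m \<in> L2 \<Omega>"
    and HJB: "AE x in ?M. hamiltonian_op \<Omega> \<A> a f u x = F m x"
    using VI by (auto simp: VI_solution_def L2_nonneg_def)
  have G_add: "G (\<lambda>x. v x + w x) = G v + G w" if "v \<in> V_space \<Omega>" "w \<in> V_space \<Omega>" for v w
    using G that by (simp add: V_dual_def)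
  have G_scale: "G (\<lambda>x. c * w x) = c * G w" if "w \<in> V_space \<Omega>" for c w
    using G that by (simp add: V_dual_def)
  define \<Gamma> where "\<Gamma> = {(W, G w) | W w. w \<in> V_space \<Omega> \<and> integrable ?M W \<and>
    (AE x in ?M. W x = m x *\<^sub>R weak_hessian \<Omega> w x)}"
  have \<Gamma>: "subspace \<Gamma>"
  proof (rule subspaceI)
    have "(\<lambda>x. 0, G (\<lambda>x. 0)) \<in> \<Gamma>"
      unfolding \<Gamma>_def using V_space_zero[OF u] weak_hessian_zero[OF u] by fastforce
    moreover have "G (\<lambda>x. 0) = 0" using G_scale[OF u, of 0] by simp
    ultimately show "0 \<in> \<Gamma>" by (simp add: zero_prod_def zero_fun_def)
  next
    fix p q assume "p \<in> \<Gamma>" "q \<in> \<Gamma>"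
    then obtain W1 w1 W2 w2 where p: "p = (W1, G w1)" "w1 \<in> V_space \<Omega>" "integrable ?M W1"
      "AE x in ?M. W1 x = m x *\<^sub>R weak_hessian \<Omega> w1 x"
      and q: "q = (W2, G w2)" "w2 \<in> V_space \<Omega>" "integrable ?M W2"
      "AE x in ?M. W2 x = m x *\<^sub>R weak_hessian \<Omega> w2 x"
      unfolding \<Gamma>_def by blast
    have "AE x in ?M. W1 x + W2 x = m x *\<^sub>R weak_hessian \<Omega> (\<lambda>x. w1 x + w2 x) x"
      using p(4) q(4) weak_hessian_add_scale[OF p(2) q(2), of 1]
      by eventually_elim (simp add: scaleR_add_right)
    moreover have "(\<lambda>x. w1 x + w2 x) \<in> V_space \<Omega>"
      using V_space_add_scale[OF p(2) q(2), of 1] by simp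
    ultimately have "((\<lambda>x. W1 x + W2 x), G (\<lambda>x. w1 x + w2 x)) \<in> \<Gamma>"
      unfolding \<Gamma>_def using p(3) q(3) by blast
    then show "p + q \<in> \<Gamma>"
      using p q by (simp add: G_add plus_fun_def)
  next
    fix c p assume "p \<in> \<Gamma>"
    then obtain W w where p: "p = (W, G w)" "w \<in> V_space \<Omega>" "integrable ?M W"
      "AE x in ?M. W x = m x *\<^sub>R weak_hessian \<Omega> w x"
      unfolding \<Gamma>_def by blast
    have "AE x in ?M. c *\<^sub>R W x = m x *\<^sub>R weak_hessian \<Omega> (\<lambda>x. c * w x) x"
      using p(4) weak_hessian_add_scale[OF V_space_zero[OF u] p(2), of c] weak_hessian_zero[OF u]
      by eventually_elim simp
    moreover have "(\<lambda>x. c * w x) \<in> V_space \<Omega>"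
      using V_space_add_scale[OF V_space_zero[OF u] p(2), of c] by simp
    moreover have "integrable ?M (\<lambda>x. c *\<^sub>R W x)" using p(3) by simp
    ultimately have "((\<lambda>x. c *\<^sub>R W x), G (\<lambda>x. c * w x)) \<in> \<Gamma>"
      unfolding \<Gamma>_def by blast
    then show "c *\<^sub>R p \<in> \<Gamma>"
      using p by (simp add: G_scale scaleR_fun_def)
  qed
  have below: "integrable ?M W \<and>
      r \<le> (LINT x|?M. H x (weak_hessian \<Omega> u x + W x) - H x (weak_hessian \<Omega> u x))"
    if Wr: "(W, r) \<in> \<Gamma>" for W r
  proof -
    obtain w where w: "r = G w" "w \<in> V_space \<Omega>" and W: "integrable ?M W"
      and ae: "AE x in ?M. W x = m x *\<^sub>R weak_hessian \<Omega> w x"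
      using Wr unfolding \<Gamma>_def by blast
    let ?mW = "\<lambda>x. m x *\<^sub>R weak_hessian \<Omega> w x"
    have "?mW \<in> borel_measurable ?M"
      using L2_D(1)[OF m] weak_hessian_measurable[OF w(2)] by (rule borel_measurable_scaleR)
    moreover have "W \<in> borel_measurable ?M" using W by (rule borel_measurable_integrable)
    ultimately have meas: "(\<lambda>x. H x (weak_hessian \<Omega> u x + Z x) - H x (weak_hessian \<Omega> u x)) \<in> borel_measurable ?M"
      if "Z = ?mW \<or> Z = W" for Z
      using that
      by (intro borel_measurable_diff H_measurable borel_measurable_add weak_hessian_measurable u) auto
    have "(LINT x|?M. H x (weak_hessian \<Omega> u x + ?mW x) - H x (weak_hessian \<Omega> u x)) =
        (LINT x|?M. H x (weak_hessian \<Omega> u x + W x) - H x (weak_hessian \<Omega> u x))"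
    proof (rule integral_cong_AE)
      show "AE x in ?M. H x (weak_hessian \<Omega> u x + ?mW x) - H x (weak_hessian \<Omega> u x) =
          H x (weak_hessian \<Omega> u x + W x) - H x (weak_hessian \<Omega> u x)"
        using ae by eventually_elim simp
    qed (intro meas; simp)+
    then show ?thesis
      using VI_linearised[OF VI G w(2)] w(1) W by simp
  qed
  obtain A where A: "A \<in> Linfty_sym \<Omega>"
    and sub: "AE x in ?M. A x \<in> partial_subdiff \<A> a f x (weak_hessian \<Omega> u x)"
    and eq: "\<And>W r. (W, r) \<in> \<Gamma> \<Longrightarrow> r = (LINT x|?M. A x \<bullet> W x)"
    using subdifferential_representation[OF weak_hessian_measurable[OF u] \<Gamma> below] by blast
  define abar where "abar x = - A x" for x
  have "L2_inner \<Omega> m (\<lambda>x. - abar x \<bullet> weak_hessian \<Omega> v x) = G v" if v: "v \<in> V_space \<Omega>" for v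
  proof -
    let ?W = "\<lambda>x. m x *\<^sub>R weak_hessian \<Omega> v x"
    have "integrable ?M ?W"
    proof (rule Bochner_Integration.integrable_bound)
      show "integrable ?M (\<lambda>x. m x * norm (weak_hessian \<Omega> v x))"
        using m norm_weak_hessian_L2[OF v] by (rule L2_mult_integrable)
      show "?W \<in> borel_measurable ?M"
        using L2_D(1)[OF m] weak_hessian_measurable[OF v] by (rule borel_measurable_scaleR)
    qed (simp add: abs_mult)
    then have "(?W, G v) \<in> \<Gamma>" unfolding \<Gamma>_def using v by blast
    from eq[OF this] show ?thesis by (simp add: L2_inner_def abar_def)
  qed
  moreover have "(\<lambda>x. - abar x) \<in> DH \<Omega> \<A> a f u"
    using A sub by (simp add: DH_def abar_def)
  ultimately show ?thesis
    using u m HJB unfolding PDI_solution_def by blast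
qed

end

theorem theorem3p1:
  fixes \<Omega> :: "(real^'d::finite) set"
    and \<A> :: "'a::metric_space set"
    and a :: "real^'d \<Rightarrow> 'a \<Rightarrow> real^'d^'d"
    and f :: "real^'d \<Rightarrow> 'a \<Rightarrow> real"
    and F :: "(real^'d \<Rightarrow> real) \<Rightarrow> (real^'d \<Rightarrow> real)"
    and G :: "(real^'d \<Rightarrow> real) \<Rightarrow> real"
  assumes "open \<Omega>" and "bounded \<Omega>"
    and "compact \<A>" and "\<A> \<noteq> {}"
    and "continuous_on (closure \<Omega> \<times> \<A>) (\<lambda>(x, \<alpha>). a x \<alpha>)"
    and "\<forall>x\<in>closure \<Omega>. \<forall>\<alpha>\<in>\<A>. a x \<alpha> \<in> sym_matrices"
    and "continuous_on (closure \<Omega> \<times> \<A>) (\<lambda>(x, \<alpha>). f x \<alpha>)"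
    and "L2_operator \<Omega> F"
    and "G \<in> V_dual \<Omega>"
  shows "(\<forall>u m. PDI_solution \<Omega> \<A> a f F G u m \<and> (AE x in lebesgue_on \<Omega>. 0 \<le> m x) \<longrightarrow>
            VI_solution \<Omega> \<A> a f F G u m) \<and>
         (\<forall>u m. VI_solution \<Omega> \<A> a f F G u m \<longrightarrow> PDI_solution \<Omega> \<A> a f F G u m)"
proof -
  interpret hamiltonian_data \<Omega> \<A> a f
    using assms by unfold_locales auto
  show ?thesis
    using PDI_imp_VI VI_imp_PDI \<open>G \<in> V_dual \<Omega>\<close> by blast
qed

end
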